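(* Let $X$ be a compact metric space, $T\colon X\to X$ continuous, and let $\mathcal M_T(X)$ be the set of $T$-invariant Borel probability measures on $X$. If a sequence $(\mu_n)_{n=1}^\infty\subset\mathcal M_T(X)$ converges in $\overline{\mathit{fk}}$ to $\mu_0\in\mathcal M_T(X)$, then \[h(\mu_0)\le\liminf_{n\to\infty}h(\mu_n),\] where $h(\mu)$ denotes the Kolmogorov–Sinai entropy of $\mu$ with respect to $T$.
   Context: Let $\rho$ be the metric of $X$; $X^\infty$ is the set of $X$-valued sequences indexed by $\mathbb N\cup\{0\}$. Feldman–Katok pseudometric: for $\underline x=(x_j),\underline z=(z_j)\in X^\infty$, $\delta>0$, $n\in\mathbb N$, an $(n,\delta)$-match is an order-preserving bijection $\pi\colon\mathcal D(\pi)\to\mathcal R(\pi)$ with $\mathcal D(\pi),\mathcal R(\pi)\subset\{0,\dots,n-1\}$ (possibly empty) and $\rho(x_i,z_{\pi(i)})<\delta$ for all $i\in\mathcal D(\pi)$; $|\pi|=|\mathcal D(\pi)|$. Put $\bar f_{n,\delta}(\underline x,\underline z)=1-\frac1n\max\{|\pi|:\pi\text{ is an }(n,\delta)\text{-match}\}$, $\bar f_\delta(\underline x,\underline z)=\limsup_{n\to\infty}\bar f_{n,\delta}(\underline x,\underline z)$, and $\overline{\mathit{fk}}(\underline x,\underline z)=\inf\{\delta>0:\bar f_\delta(\underline x,\underline z)<\delta\}$. A sequence $\underline x\in X^\infty$ is generic for a Borel probability measure $\mu$ if $\frac1n\sum_{j=0}^{n-1}\delta_{x_j}\to\mu$ in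 the weak$^*$ topology. A quasi-orbit for $T$ is $\underline z\in X^\infty$ such that $\{n\ge0:z_{n+1}\ne T(z_n)\}$ has upper asymptotic density $0$. Convergence in $\overline{\mathit{fk}}$: $(\mu_n)\subset\mathcal M_T(X)$ converges in $\overline{\mathit{fk}}$ to $\mu\in\mathcal M_T(X)$ if there are quasi-orbits $\underline x^{(n)}\in X^\infty$, with $\underline x^{(n)}$ generic for $\mu_n$, and a quasi-orbit $\underline z\in X^\infty$ generic for $\mu$, such that $\overline{\mathit{fk}}(\underline z,\underline x^{(n)})\to0$ as $n\to\infty$. *)

theory Defs
  imports "HOL-Probability.Probability"
begin

text \<open>
  The compact metric space is a type of class \<open>metric_space\<close> whose universe is compact, with
  \<open>dist\<close> as its metric. Elements of $X^\infty$ are functions from \<open>nat\<close>.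
\<close>

section \<open>The Feldman--Katok pseudometric\<close>

definition is_match ::
  "nat \<Rightarrow> real \<Rightarrow> (nat \<Rightarrow> 'a::metric_space) \<Rightarrow> (nat \<Rightarrow> 'a) \<Rightarrow> nat set \<Rightarrow> nat set \<Rightarrow> (nat \<Rightarrow> nat) \<Rightarrow> bool"
  where
  "is_match n \<delta> x z D R \<pi> \<longleftrightarrow>
     D \<subseteq> {..<n} \<and> R \<subseteq> {..<n} \<and> bij_betw \<pi> D R \<and> mono_on D \<pi> \<and>
     (\<forall>i\<in>D. dist (x i) (z (\<pi> i)) < \<delta>)"

definition match_sizes ::
  "nat \<Rightarrow> real \<Rightarrow> (nat \<Rightarrow> 'a::metric_space) \<Rightarrow> (nat \<Rightarrow> 'a) \<Rightarrow> nat set" where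
  "match_sizes n \<delta> x z = {card D |D R \<pi>. is_match n \<delta> x z D R \<pi>}"

text \<open>The maximum in the next definition is over a finite nonempty set.\<close>

lemma finite_match_sizes: "finite (match_sizes n \<delta> x z)"
proof (rule finite_subset)
  show "match_sizes n \<delta> x z \<subseteq> {..n}"
    using card_mono[of "{..<n}"] by (force simp: match_sizes_def is_match_def)
qed simp

lemma match_sizes_nonempty: "match_sizes n \<delta> x z \<noteq> {}"
proof -
  have "is_match n \<delta> x z {} {} id"
    by (simp add: is_match_def)
  then show ?thesis
    unfolding match_sizes_def by blast
qed

definition f_bar_n ::
  "nat \<Rightarrow> real \<Rightarrow> (nat \<Rightarrow> 'a::metric_space) \<Rightarrow> (nat \<Rightarrow> 'a) \<Rightarrow> real" where
  "f_bar_n n \<delta> x z = 1 - real (Max (match_sizes n \<delta> x z)) / real n"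

definition f_bar ::
  "real \<Rightarrow> (nat \<Rightarrow> 'a::metric_space) \<Rightarrow> (nat \<Rightarrow> 'a) \<Rightarrow> ereal" where
  "f_bar \<delta> x z = limsup (\<lambda>n. ereal (f_bar_n n \<delta> x z))"

definition fk_bar :: "(nat \<Rightarrow> 'a::metric_space) \<Rightarrow> (nat \<Rightarrow> 'a) \<Rightarrow> real" where
  "fk_bar x z = Inf {\<delta>::real. 0 < \<delta> \<and> f_bar \<delta> x z < ereal \<delta>}"


section \<open>Invariant measures, generic sequences and quasi-orbits\<close>

definition invariant_measures :: "('a::metric_space \<Rightarrow> 'a) \<Rightarrow> 'a measure set" where
  "invariant_measures T = {\<mu>. prob_space \<mu> \<and> sets \<mu> = sets borel \<and> distr \<mu> borel T = \<mu>}"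

definition weak_star_conv :: "(nat \<Rightarrow> 'a::metric_space measure) \<Rightarrow> 'a measure \<Rightarrow> bool" where
  "weak_star_conv \<nu> \<mu> \<longleftrightarrow>
     (\<forall>f :: 'a \<Rightarrow> real. continuous_on UNIV f \<longrightarrow>
        (\<lambda>n. integral\<^sup>L (\<nu> n) f) \<longlonglongrightarrow> integral\<^sup>L \<mu> f)"

definition empirical_measure :: "(nat \<Rightarrow> 'a::metric_space) \<Rightarrow> nat \<Rightarrow> 'a measure" where
  "empirical_measure x n = distr (uniform_count_measure {..<n}) borel x"

lemma integral_empirical_measure:
  fixes f :: "'a::metric_space \<Rightarrow> real"
  assumes "continuous_on UNIV f"
  shows "integral\<^sup>L (empirical_measure x n) f = (\<Sum>j<n. f (x j)) / real n"
proof -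
  have "f \<in> borel_measurable borel"
    using assms by (rule borel_measurable_continuous_onI)
  moreover have "x \<in> measurable (uniform_count_measure {..<n}) borel"
    by (simp add: measurable_def space_uniform_count_measure sets_uniform_count_measure)
  ultimately show ?thesis
    unfolding empirical_measure_def
    by (simp add: integral_distr integral_uniform_count_measure)
qed

definition generic :: "(nat \<Rightarrow> 'a::metric_space) \<Rightarrow> 'a measure \<Rightarrow> bool" where
  "generic x \<mu> \<longleftrightarrow> weak_star_conv (empirical_measure x) \<mu>"

definition upper_density :: "nat set \<Rightarrow> ereal" where
  "upper_density A = limsup (\<lambda>n. ereal (real (card (A \<inter> {..<n})) / real n))"

definition quasi_orbit :: "('a \<Rightarrow> 'a) \<Rightarrow> (nat \<Rightarrow> 'a) \<Rightarrow> bool" where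
  "quasi_orbit T z \<longleftrightarrow> upper_density {n. z (Suc n) \<noteq> T (z n)} = 0"

text \<open>Sequences of measures are indexed from 1; the value at index 0 is irrelevant.\<close>

definition fk_converges ::
  "('a::metric_space \<Rightarrow> 'a) \<Rightarrow> (nat \<Rightarrow> 'a measure) \<Rightarrow> 'a measure \<Rightarrow> bool" where
  "fk_converges T \<mu> \<mu>\<^sub>0 \<longleftrightarrow>
     (\<exists>(x :: nat \<Rightarrow> nat \<Rightarrow> 'a) (z :: nat \<Rightarrow> 'a).
        (\<forall>n\<ge>1. quasi_orbit T (x n) \<and> generic (x n) (\<mu> n)) \<and>
        quasi_orbit T z \<and> generic z \<mu>\<^sub>0 \<and>
        (\<lambda>n. fk_bar z (x n)) \<longlonglongrightarrow> 0)"


section \<open>Kolmogorov--Sinai entropy\<close>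

definition finite_meas_partition :: "'a measure \<Rightarrow> 'a set set \<Rightarrow> bool" where
  "finite_meas_partition \<mu> P \<longleftrightarrow> finite P \<and> P \<subseteq> sets \<mu> \<and> partition_on (space \<mu>) P"

text \<open>Shannon entropy; the convention $0 \log 0 = 0$ holds automatically.\<close>

definition partition_entropy :: "'a measure \<Rightarrow> 'a set set \<Rightarrow> real" where
  "partition_entropy \<mu> P = - (\<Sum>A\<in>P. measure \<mu> A * ln (measure \<mu> A))"

text \<open>
  The join $\bigvee_{i=0}^{n-1} T^{-i}P$: its cells are the nonempty sets
  $\bigcap_{i<n} T^{-i}(A_i)$ with all $A_i$ in $P$.
\<close>

definition iterated_join :: "('a \<Rightarrow> 'a) \<Rightarrow> 'a set set \<Rightarrow> nat \<Rightarrow> 'a set set" where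
  "iterated_join T P n =
     {\<Inter>i\<in>{..<n}. (T ^^ i) -` A i |A :: nat \<Rightarrow> 'a set. \<forall>i<n. A i \<in> P} - {{}}"

text \<open>For invariant measures the limit exists by subadditivity.\<close>

definition entropy_wrt :: "('a \<Rightarrow> 'a) \<Rightarrow> 'a measure \<Rightarrow> 'a set set \<Rightarrow> real" where
  "entropy_wrt T \<mu> P = lim (\<lambda>n. partition_entropy \<mu> (iterated_join T P n) / real n)"

definition KS_entropy :: "('a \<Rightarrow> 'a) \<Rightarrow> 'a measure \<Rightarrow> ereal" where
  "KS_entropy T \<mu> = (SUP P\<in>{P. finite_meas_partition \<mu> P}. ereal (entropy_wrt T \<mu> P))"

end

theory Submission
  imports Defs
begin

text \<open>
  Approximate the cells of a finite partition from inside by disjoint closed sets \<open>K A\<close>. Closed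
  neighbourhoods of the \<open>K A\<close> of radius \<open>r\<close> label the orbit \<open>z\<close>, and slightly larger ones of radius
  \<open>r'\<close> label the orbit \<open>x n\<close>; the radii are chosen so that all boundaries are null sets. If
  \<open>z\<close> and \<open>x n\<close> are close in the Feldman--Katok pseudometric, most labels of \<open>z\<close> equal those of
  \<open>x n\<close> under an order-preserving matching. Hence a window of labels of \<open>z\<close> can be
  recovered from the corresponding window of labels of \<open>x n\<close> and a short description of which
  positions are unmatched. By Gibbs' inequality this bounds the block entropies of \<open>z\<close> by those of
  \<open>x n\<close> up to a small multiple of the block length, and by genericity these block
  entropies converge to the entropies of the iterated joins.
\<close>

section \<open>Gibbs' inequality for finite distributions\<close>

text \<open>The order of limits is the difficulty: \<open>\<delta>\<close> stays fixed while the
  block length \<open>m\<close> tends to infinity, and once \<open>m * \<delta>\<close> is large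
  every window may contain an unmatched position. Comparing windows as whole symbols then gives
  nothing; the loss must be counted per position, as \<open>m\<close> times a constant that is small
  with \<open>\<delta>\<close>. Moreover a matching may drift, so windows are paired along
  \<open>\<pi>\<close> and not at equal times. Corrections are therefore coded by explicit product
  distributions, against which the cost is a sum over positions. The parameter \<open>q\<close> is
  an assumed error probability: a marker costs \<open>- ln (1 - q)\<close> at every position, an
  error up to \<open>ln (card L / q)\<close>. Hence \<open>q\<close> is fixed first and the
  admissible fraction of errors only afterwards. The second radius depends on the approximating
  measure, whose null spheres are not known beforehand, but it is sought in a fixed interval, so the
  required closeness is uniform over all approximating measures.\<close>

definition shannon :: "'v set \<Rightarrow> ('v \<Rightarrow> real) \<Rightarrow> real" where
  "shannon V p = - (\<Sum>v\<in>V. p v * ln (p v))"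

definition push :: "'j set \<Rightarrow> ('j \<Rightarrow> real) \<Rightarrow> ('j \<Rightarrow> 'v) \<Rightarrow> 'v \<Rightarrow> real" where
  "push J p X v = sum p {j\<in>J. X j = v}"

text \<open>Entropy is the mean of the information at the observed value; in this form entropies of
  different variables on the same \<open>J\<close> can be compared termwise.\<close>

lemma shannon_push:
  assumes "finite J" "finite V" "X ` J \<subseteq> V"
  shows "shannon V (push J p X) = - (\<Sum>j\<in>J. p j * ln (push J p X (X j)))"
proof -
  have "(\<Sum>j\<in>J. p j * ln (push J p X (X j)))
      = (\<Sum>v\<in>V. \<Sum>j\<in>{j\<in>J. X j = v}. p j * ln (push J p X (X j)))"
    using assms by (subst sum.group) auto
  also have "\<dots> = (\<Sum>v\<in>V. push J p X v * ln (push J p X v))"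
    by (intro sum.cong refl) (simp add: push_def sum_distrib_right)
  finally show ?thesis
    by (simp add: shannon_def)
qed

lemma sum_push:
  assumes "finite J" "finite V" "X ` J \<subseteq> V"
  shows "(\<Sum>v\<in>V. push J p X v) = sum p J"
  unfolding push_def using assms by (rule sum.group)

lemma push_nonneg: "(\<And>j. j \<in> J \<Longrightarrow> 0 \<le> p j) \<Longrightarrow> 0 \<le> push J p X v"
  unfolding push_def by (rule sum_nonneg) simp

lemma push_ge:
  assumes "finite J" "\<And>j. j \<in> J \<Longrightarrow> 0 \<le> p j" "j \<in> J"
  shows "p j \<le> push J p X (X j)"
  unfolding push_def using assms by (intro member_le_sum) auto

text \<open>\<open>X\<close> is a function of the pair \<open>(Y, E)\<close>, so its entropy is at
  most that of \<open>Y\<close> plus a cost for \<open>E\<close>. The cost is a cross-entropy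
  against a freely chosen subprobability \<open>r\<close>, which can be estimated without knowing
  the true law of \<open>E\<close>.\<close>

lemma gibbs:
  fixes p :: "'j \<Rightarrow> real" and r :: "'e \<Rightarrow> real"
  assumes fin: "finite J" "finite VX" "finite VY" "finite VE"
    and sub: "X ` J \<subseteq> VX" "Y ` J \<subseteq> VY" "E ` J \<subseteq> VE"
    and p0: "\<And>j. j \<in> J \<Longrightarrow> 0 \<le> p j" and p1: "sum p J = 1"
    and r0: "\<And>e. e \<in> VE \<Longrightarrow> 0 \<le> r e" and r1: "sum r VE \<le> 1"
    and rpos: "\<And>j. j \<in> J \<Longrightarrow> 0 < p j \<Longrightarrow> 0 < r (E j)"
    and det: "\<And>i j. i \<in> J \<Longrightarrow> j \<in> J \<Longrightarrow> Y i = Y j \<Longrightarrow> E i = E j \<Longrightarrow> X i = X j"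
  shows "shannon VX (push J p X) \<le> shannon VY (push J p Y) + (\<Sum>j\<in>J. p j * - ln (r (E j)))"
proof -
  let ?PX = "push J p X" and ?PY = "push J p Y" and ?Z = "\<lambda>j. (Y j, E j)"
  let ?PZ = "push J p ?Z"
  let ?u = "\<lambda>j. ?PY (Y j) * r (E j) / ?PX (X j)"
  have log_le: "p j * (ln (?PY (Y j)) + ln (r (E j)) - ln (?PX (X j))) \<le> p j * ?u j - p j"
    if j: "j \<in> J" for j
  proof (cases "p j = 0")
    case False
    then have pj: "0 < p j" using p0[OF j] by simp
    have "0 < ?PX (X j)" "0 < ?PY (Y j)"
      using push_ge[of J p j X] push_ge[of J p j Y] fin p0 j pj by fastforce+
    moreover have "0 < r (E j)" using rpos j pj by simp
    ultimately have "ln (?PY (Y j)) + ln (r (E j)) - ln (?PX (X j)) = ln (?u j)" and "0 < ?u j"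
      by (simp_all add: ln_div ln_mult)
    then have "ln (?PY (Y j)) + ln (r (E j)) - ln (?PX (X j)) \<le> ?u j - 1"
      using ln_le_minus_one[of "?u j"] by simp
    then show ?thesis
      using mult_left_mono[of _ _ "p j"] p0[OF j] by (fastforce simp: algebra_simps)
  qed simp
  \<comment> \<open>On a fibre of \<open>(Y, E)\<close> the variable \<open>X\<close> is constant by
    \<open>det\<close>, so the mass of the fibre is at most the probability of that value of
    \<open>X\<close>, which cancels the denominator of \<open>?u\<close>.\<close>
  have "(\<Sum>j\<in>J. p j * ?u j) = (\<Sum>z\<in>VY \<times> VE. \<Sum>j\<in>{j\<in>J. ?Z j = z}. p j * ?u j)"
    using fin sub by (subst sum.group) auto
  also have "\<dots> \<le> (\<Sum>z\<in>VY \<times> VE. ?PY (fst z) * r (snd z))"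
  proof (rule sum_mono)
    fix z assume z: "z \<in> VY \<times> VE"
    let ?F = "{j\<in>J. ?Z j = z}"
    have nn: "0 \<le> ?PY (fst z) * r (snd z)"
      using z r0 push_nonneg[of J p Y] p0 by auto
    show "(\<Sum>j\<in>?F. p j * ?u j) \<le> ?PY (fst z) * r (snd z)"
    proof (cases "?F = {}")
      case False
      then obtain i where i: "i \<in> J" "?Z i = z" by auto
      have same: "X j = X i" if "j \<in> ?F" for j
        using det[of j i] that i by auto
      have "(\<Sum>j\<in>?F. p j * ?u j) = (\<Sum>j\<in>?F. p j) * (?PY (fst z) * r (snd z) / ?PX (X i))"
        unfolding sum_distrib_right using same by (intro sum.cong refl) auto
      also have "\<dots> \<le> ?PX (X i) * (?PY (fst z) * r (snd z) / ?PX (X i))"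
      proof (rule mult_right_mono)
        show "(\<Sum>j\<in>?F. p j) \<le> ?PX (X i)"
          unfolding push_def using same fin p0 by (intro sum_mono2) auto
        show "0 \<le> ?PY (fst z) * r (snd z) / ?PX (X i)"
          using nn push_nonneg[of J p X] p0 by simp
      qed
      also have "\<dots> \<le> ?PY (fst z) * r (snd z)"
        using nn by simp
      finally show ?thesis .
    next
      case True
      then show ?thesis
        using nn by (simp only: sum.empty)
    qed
  qed
  also have "\<dots> = (\<Sum>v\<in>VY. ?PY v) * sum r VE"
    by (simp add: sum_product sum.cartesian_product case_prod_unfold)
  also have "\<dots> \<le> 1"
    using r1 sum_push[of J VY Y p] fin sub p1 by simp
  finally have "(\<Sum>j\<in>J. p j * ?u j) \<le> 1" .
  moreover have "(\<Sum>j\<in>J. p j * (ln (?PY (Y j)) + ln (r (E j)) - ln (?PX (X j))))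
      \<le> (\<Sum>j\<in>J. p j * ?u j) - sum p J"
    unfolding sum_subtractf[symmetric] by (rule sum_mono) (rule log_le)
  ultimately show ?thesis
    using p1 fin sub by (simp add: shannon_push algebra_simps sum.distrib sum_subtractf sum_negf)
qed

text \<open>For weights of total mass 1 this makes the product weights a probability distribution on
  words of length \<open>n\<close>, which is the form of \<open>r\<close> given to
  \<open>gibbs\<close>.\<close>

lemma sum_prod_list:
  fixes r :: "'b \<Rightarrow> real"
  assumes "finite A"
  shows "(\<Sum>xs\<in>{xs. set xs \<subseteq> A \<and> length xs = n}. prod_list (map r xs)) = sum r A ^ n"
proof (induction n)
  case 0
  have "{xs. set xs \<subseteq> A \<and> length xs = 0} = {[]}" by auto
  then show ?case by simp
next
  case (Suc n)
  let ?S = "{xs. set xs \<subseteq> A \<and> length xs = n}"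
  have "{xs. set xs \<subseteq> A \<and> length xs = Suc n} = (\<lambda>(x, xs). x # xs) ` (A \<times> ?S)"
    by (auto simp: length_Suc_conv image_iff)
  moreover have "inj_on (\<lambda>(x, xs). x # xs) (A \<times> ?S)"
    by (auto simp: inj_on_def)
  ultimately have "(\<Sum>xs\<in>{xs. set xs \<subseteq> A \<and> length xs = Suc n}. prod_list (map r xs))
      = (\<Sum>(x, xs)\<in>A \<times> ?S. r x * prod_list (map r xs))"
    by (simp add: sum.reindex case_prod_unfold)
  also have "\<dots> = sum r A * (\<Sum>xs\<in>?S. prod_list (map r xs))"
    by (simp add: sum_product sum.cartesian_product)
  finally show ?case
    using Suc.IH by simp
qed

lemma shannon_le_superset:
  assumes "finite W" "V \<subseteq> W" "\<And>v. v \<in> W - V \<Longrightarrow> p v = 0"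
  shows "shannon W p = shannon V p"
  unfolding shannon_def using assms by (intro arg_cong[where f=uminus] sum.mono_neutral_right) auto

section \<open>Block entropies of matched sequences\<close>

definition window :: "nat \<Rightarrow> (nat \<Rightarrow> 'b) \<Rightarrow> nat \<Rightarrow> 'b list" where
  "window m w s = map w [s..<s + m]"

lemma length_window [simp]: "length (window m w s) = m"
  by (simp add: window_def)

lemma nth_window [simp]: "j < m \<Longrightarrow> window m w s ! j = w (s + j)"
  by (simp add: window_def)

lemma window_in: "range w \<subseteq> L \<Longrightarrow> window m w s \<in> {xs. set xs \<subseteq> L \<and> length xs = m}"
  by (auto simp: window_def)

lemma ln_prod_list:
  fixes xs :: "real list"
  shows "(\<And>x. x \<in> set xs \<Longrightarrow> 0 < x) \<Longrightarrow> 0 < prod_list xs \<and> ln (prod_list xs) = sum_list (map ln xs)"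
  by (induction xs) (auto simp: ln_mult)

text \<open>An increasing bijection preserves rank, so the image of \<open>j\<close> is the element
  of \<open>F\<close> with as many predecessors in \<open>F\<close> as \<open>j\<close> has in
  \<open>E\<close>.\<close>

lemma mono_bij_unique:
  fixes f g :: "nat \<Rightarrow> nat"
  assumes fin: "finite E" and f: "bij_betw f E F" "mono_on E f" and g: "bij_betw g E F" "mono_on E g"
    and j: "j \<in> E"
  shows "f j = g j"
proof -
  have below: "card {k \<in> F. k < h j} = card {i \<in> E. i < j}"
    if h: "bij_betw h E F" "mono_on E h" for h
  proof -
    have inj: "inj_on h E" and F: "F = h ` E"
      using h(1) by (auto simp: bij_betw_def)
    have "h i < h j \<longleftrightarrow> i < j" if i: "i \<in> E" for i
    proof
      assume "h i < h j"
      then show "i < j"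
        using mono_onD[OF h(2) j i] by (meson leD leI)
    next
      assume "i < j"
      then have "h i \<le> h j" "h i \<noteq> h j"
        using mono_onD[OF h(2) i j] inj_onD[OF inj _ i j] by auto
      then show "h i < h j" by simp
    qed
    then have "{k \<in> F. k < h j} = h ` {i \<in> E. i < j}"
      by (auto simp: F)
    then show ?thesis
      using inj by (simp add: card_image inj_on_def)
  qed
  have lt: "card {k \<in> F. k < a} < card {k \<in> F. k < b}" if "a < b" "a \<in> F" for a b
    using that fin f(1) bij_betw_finite[of f E F] by (intro psubset_card_mono) auto
  have "f j \<in> F" "g j \<in> F"
    using f(1) g(1) j by (auto simp: bij_betw_def)
  then show ?thesis
    using lt[of "f j" "g j"] lt[of "g j" "f j"] below[OF f] below[OF g]
    by (metis less_irrefl linorder_neqE_nat)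
qed

text \<open>Double counting: for each offset \<open>j\<close> the points \<open>s + j\<close>
  outside \<open>D\<close> are distinct elements of \<open>{..<N + j}\<close>. The extra
  \<open>m\<close> pays for windows that overhang \<open>N\<close>.\<close>

lemma sum_window_gaps:
  fixes D :: "nat set"
  assumes "D \<subseteq> {..<N}"
  shows "(\<Sum>s<N. card {j. j < m \<and> s + j \<notin> D}) \<le> m * (N - card D + m)"
proof -
  have fin: "finite D" using assms finite_subset by blast
  have "(\<Sum>s<N. card {j. j < m \<and> s + j \<notin> D})
      = (\<Sum>s<N. \<Sum>j<m. if s + j \<notin> D then 1 else 0)"
    by (intro sum.cong refl) (simp add: sum.If_cases Collect_conj_eq lessThan_def)
  also have "\<dots> = (\<Sum>j<m. \<Sum>s<N. if s + j \<notin> D then 1 else 0)"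
    by (rule sum.swap)
  also have "\<dots> = (\<Sum>j<m. card {s. s < N \<and> s + j \<notin> D})"
    by (intro sum.cong refl) (simp add: sum.If_cases Collect_conj_eq lessThan_def)
  also have "\<dots> \<le> (\<Sum>j<m. N - card D + m)"
  proof (rule sum_mono)
    fix j assume "j \<in> {..<m}"
    have "card {s. s < N \<and> s + j \<notin> D} = card ((\<lambda>s. s + j) ` {s. s < N \<and> s + j \<notin> D})"
      by (simp add: card_image)
    also have "\<dots> \<le> card ({..<N + j} - D)"
      by (intro card_mono) auto
    also have "\<dots> = N + j - card D"
      using assms fin by (subst card_Diff_subset) auto
    finally show "card {s. s < N \<and> s + j \<notin> D} \<le> N - card D + m"
      using \<open>j \<in> {..<m}\<close> by simp
  qed
  finally show ?thesis by simp
qed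

section \<open>Increasing matchings and the windows they pair\<close>

locale match =
  fixes N :: nat and D R :: "nat set" and \<pi> :: "nat \<Rightarrow> nat"
  assumes D: "D \<subseteq> {..<N}" and R: "R \<subseteq> {..<N}"
    and bij: "bij_betw \<pi> D R" and mono: "mono_on D \<pi>"
begin

lemma inj: "inj_on \<pi> D" and img: "\<pi> ` D = R"
  using bij by (auto simp: bij_betw_def)

lemma finD: "finite D" and finR: "finite R"
  using D R finite_subset by blast+

lemma card_R: "card R = card D"
  using bij by (simp add: bij_betw_same_card)

lemma le_iff: "i \<in> D \<Longrightarrow> j \<in> D \<Longrightarrow> \<pi> i \<le> \<pi> j \<longleftrightarrow> i \<le> j"
  using mono_onD[OF mono] inj_onD[OF inj] by (metis nle_le)

text \<open>A permutation is wanted because sampling the second sequence at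
  \<open>\<sigma> s\<close> with \<open>s\<close> uniform then yields the same block distribution as
  sampling it at \<open>s\<close>. Off \<open>D\<close> any bijection will do, the complements of
  \<open>D\<close> and \<open>R\<close> having equal size.\<close>

lemma permutation_extending_match:
  obtains \<sigma> where "bij_betw \<sigma> {..<N} {..<N}" "\<And>s. s \<in> D \<Longrightarrow> \<sigma> s = \<pi> s"
proof -
  have "card ({..<N} - D) = card ({..<N} - R)"
    using D R finD finR by (simp add: card_Diff_subset card_R)
  then obtain h where h: "bij_betw h ({..<N} - D) ({..<N} - R)"
    using finite_same_card_bij[of "{..<N} - D" "{..<N} - R"] by auto
  let ?\<sigma> = "\<lambda>s. if s \<in> D then \<pi> s else h s"
  have "bij_betw ?\<sigma> (D \<union> ({..<N} - D)) (R \<union> ({..<N} - R))"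
  proof (rule bij_betw_combine)
    show "bij_betw ?\<sigma> D R" using bij by (rule bij_betw_cong[THEN iffD1, rotated]) simp
    show "bij_betw ?\<sigma> ({..<N} - D) ({..<N} - R)"
      using h by (rule bij_betw_cong[THEN iffD1, rotated]) simp
  qed simp
  then show ?thesis
    using D R that[of ?\<sigma>] by (simp add: Un_absorb1)
qed

text \<open>\<open>matched m s\<close> are the positions of the window at \<open>s\<close> whose partner lies in the window at \<open>\<pi> s\<close>,
  and \<open>shift s\<close> sends them to their partners.\<close>

definition matched :: "nat \<Rightarrow> nat \<Rightarrow> nat set" where
  "matched m s = (if s \<in> D then {j. j < m \<and> s + j \<in> D \<and> \<pi> (s + j) < \<pi> s + m} else {})"

definition shift :: "nat \<Rightarrow> nat \<Rightarrow> nat" where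
  "shift s j = \<pi> (s + j) - \<pi> s"

lemma matched_subset: "matched m s \<subseteq> {..<m}" 
  by (auto simp: matched_def)

lemma finite_matched [simp]: "finite (matched m s)"
  using matched_subset finite_subset by blast

lemma matchedD:
  assumes "j \<in> matched m s"
  shows "j < m" "s \<in> D" "s + j \<in> D" "\<pi> (s + j) = \<pi> s + shift s j" "shift s j < m"
  using assms le_iff[of s "s + j"] by (auto simp: matched_def shift_def split: if_splits)

lemma shift_bij: "bij_betw (shift s) (matched m s) (shift s ` matched m s)"
  unfolding bij_betw_def
proof (intro conjI refl inj_onI)
  fix i j assume "i \<in> matched m s" "j \<in> matched m s" "shift s i = shift s j"
  then show "i = j"
    using matchedD(3,4)[of i m s] matchedD(3,4)[of j m s] inj_onD[OF inj, of "s + i" "s + j"] by simp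
qed

lemma shift_mono: "mono_on (matched m s) (shift s)"
proof (rule mono_onI)
  fix i j assume "i \<in> matched m s" "j \<in> matched m s" "i \<le> j"
  then show "shift s i \<le> shift s j"
    using matchedD(3,4)[of i m s] matchedD(3,4)[of j m s] le_iff[of "s + i" "s + j"] by simp
qed

lemma shift_subset: "shift s ` matched m s \<subseteq> {..<m}"
  using matchedD(5) by auto

text \<open>The code pays for the gaps of both windows; having equal length and equally many matched
  positions, they have equally many gaps.\<close>

lemma card_unmatched_shift:
  "card ({..<m} - shift s ` matched m s) = card ({..<m} - matched m s)"
  using shift_subset matched_subset shift_bij[of s m]
  by (simp add: card_Diff_subset bij_betw_same_card[symmetric])

text \<open>Either every partner of the window at \<open>s\<close> lies in the window at \<open>\<pi> s\<close>, or
  every partner of the window at \<open>\<pi> s\<close> lies in the window at \<open>s\<close>.\<close>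

lemma card_unmatched_le:
  assumes s: "s \<in> D"
  shows "card ({..<m} - matched m s)
    \<le> card {j. j < m \<and> s + j \<notin> D} + card {j. j < m \<and> \<pi> s + j \<notin> R}"
proof (cases "\<exists>j<m. s + j \<in> D \<and> \<pi> s + m \<le> \<pi> (s + j)")
  case False
  then have "{..<m} - matched m s \<subseteq> {j. j < m \<and> s + j \<notin> D}"
    using s by (auto simp: matched_def not_le)
  then show ?thesis
    by (intro trans_le_add1 card_mono) auto
next
  case True
  then obtain j0 where j0: "j0 < m" "s + j0 \<in> D" "\<pi> s + m \<le> \<pi> (s + j0)" by auto
  \<comment> \<open>The position \<open>s + j0\<close> is sent beyond the image window. By
    monotonicity, the preimages of points of that window lie from \<open>s\<close> up to before
    \<open>s + j0\<close>, hence inside the window at \<open>s\<close>.\<close>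
  have "k \<in> shift s ` matched m s" if k: "k < m" "\<pi> s + k \<in> R" for k
  proof -
    obtain i where i: "i \<in> D" "\<pi> i = \<pi> s + k" using k img by (metis imageE)
    have "s \<le> i" using le_iff[OF s i(1)] i(2) by simp
    moreover have "\<not> s + j0 \<le> i" using le_iff[OF j0(2) i(1)] j0 i k by simp
    ultimately have "i - s \<in> matched m s" "shift s (i - s) = k"
      using i s j0 k by (auto simp: matched_def shift_def)
    then show ?thesis by blast
  qed
  then have "{..<m} - shift s ` matched m s \<subseteq> {j. j < m \<and> \<pi> s + j \<notin> R}" by auto
  then have "card ({..<m} - shift s ` matched m s) \<le> card {j. j < m \<and> \<pi> s + j \<notin> R}"
    by (intro card_mono) auto
  then show ?thesis
    by (simp add: card_unmatched_shift)
qed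

text \<open>One share of \<open>m * (N - card D)\<close> comes from starting points outside
  \<open>D\<close>, where nothing counts as matched; the other two are the gaps of \<open>D\<close>
  and of \<open>R\<close>. The two overhangs give \<open>2 * m\<^sup>2\<close>.\<close>

lemma sum_unmatched_le:
  "(\<Sum>s<N. card ({..<m} - matched m s)) \<le> 3 * m * (N - card D) + 2 * m\<^sup>2"
proof -
  have "(\<Sum>s<N. card ({..<m} - matched m s))
      = (\<Sum>s\<in>D. card ({..<m} - matched m s)) + (\<Sum>s\<in>{..<N} - D. card ({..<m} - matched m s))"
    using D by (subst sum.subset_diff[of D "{..<N}"]) auto
  also have "(\<Sum>s\<in>{..<N} - D. card ({..<m} - matched m s)) = m * (N - card D)"
    using D finD by (simp add: matched_def card_Diff_subset)
  also have "(\<Sum>s\<in>D. card ({..<m} - matched m s))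
      \<le> (\<Sum>s\<in>D. card {j. j < m \<and> s + j \<notin> D}) + (\<Sum>s\<in>D. card {j. j < m \<and> \<pi> s + j \<notin> R})"
    unfolding sum.distrib[symmetric] by (intro sum_mono card_unmatched_le)
  also have "(\<Sum>s\<in>D. card {j. j < m \<and> \<pi> s + j \<notin> R}) = (\<Sum>s\<in>R. card {j. j < m \<and> s + j \<notin> R})"
    using bij by (rule sum.reindex_bij_betw)
  also have "\<dots> \<le> (\<Sum>s<N. card {j. j < m \<and> s + j \<notin> R})"
    using R by (intro sum_mono2) auto
  also have "\<dots> \<le> m * (N - card D + m)"
    using sum_window_gaps[OF R] by (simp add: card_R)
  also have "(\<Sum>s\<in>D. card {j. j < m \<and> s + j \<notin> D}) \<le> (\<Sum>s<N. card {j. j < m \<and> s + j \<notin> D})"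
    using D by (intro sum_mono2) auto
  also have "\<dots> \<le> m * (N - card D + m)"
    by (rule sum_window_gaps[OF D])
  finally show ?thesis
    by (simp add: algebra_simps power2_eq_square)
qed

text \<open>\<open>gibbs\<close> with \<open>Y\<close> the window of \<open>w'\<close> at the
  partner and \<open>E\<close> the code word. An unmatched position costs
  \<open>ln (card L / q)\<close> in each of the two coordinates of the code, whence the factor 2;
  the markers cost at most \<open>- 2 * m * ln (1 - q)\<close> altogether.\<close>

lemma block_entropy_le:
  fixes w w' :: "nat \<Rightarrow> 'b" and L :: "'b set" and m :: nat
  assumes agree: "\<And>i. i \<in> D \<Longrightarrow> w i = w' (\<pi> i)"
    and L: "finite L" "range w \<subseteq> L" "range w' \<subseteq> L" and q: "0 < q" "q < 1" and N: "0 < N"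
  defines "V \<equiv> {xs. set xs \<subseteq> L \<and> length xs = m}"
  shows "shannon V (push {..<N} (\<lambda>_. 1 / real N) (window m w))
    \<le> shannon V (push {..<N} (\<lambda>_. 1 / real N) (window m w'))
      + 2 * (real (3 * m * (N - card D) + 2 * m\<^sup>2) / real N) * ln (card L / q) - 2 * m * ln (1 - q)"
proof -
  obtain \<sigma> where \<sigma>: "bij_betw \<sigma> {..<N} {..<N}" "\<And>s. s \<in> D \<Longrightarrow> \<sigma> s = \<pi> s"
    by (rule permutation_extending_match) blast
  let ?p = "\<lambda>_::nat. 1 / real N" and ?J = "{..<N}"
  let ?A = "insert None (Some ` L) \<times> (UNIV :: bool set)"
  let ?VE = "{xs. set xs \<subseteq> ?A \<and> length xs = m}"
  \<comment> \<open>The law of one code letter, with independent coordinates. The first is the mark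
    \<open>None\<close> with probability \<open>1 - q\<close> and otherwise a uniform symbol of
    \<open>L\<close>; the second says whether the position in the partner window is matched.\<close>
  define \<rho> where "\<rho> = (\<lambda>(a :: 'b option, b). (if a = None then 1 - q else q / card L) * (if b then 1 - q else q))"
  \<comment> \<open>The code marks the matched positions of both windows and spells out the unmatched symbols;
    as \<open>shift s\<close> is the only increasing bijection between the matched positions, it need not be recorded.\<close>
  define code where "code = (\<lambda>s. map (\<lambda>j. (if j \<in> matched m s then None else Some (w (s + j)),
      j \<in> shift s ` matched m s)) [0..<m])"
  let ?r = "\<lambda>e. prod_list (map \<rho> e)"
  have "L \<noteq> {}" using L(2) by auto
  then have cL: "1 \<le> real (card L)"
    using L(1) by (simp add: Suc_le_eq card_gt_0_iff)
  have lam: "0 \<le> ln (card L / q)" "ln (1 / q) \<le> ln (card L / q)"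
    using q cL by (simp_all add: divide_right_mono)
  have \<rho>pos: "0 < \<rho> x" for x
    using q cL by (auto simp: \<rho>_def split: prod.splits)
  have rpos: "0 < ?r e" for e
    by (induction e) (simp_all add: \<rho>pos)
  have "sum \<rho> ?A = (\<Sum>a\<in>insert None (Some ` L). if a = None then 1 - q else q / card L) * (\<Sum>b\<in>UNIV. if b then 1 - q else q)"
    by (simp add: \<rho>_def sum_product sum.cartesian_product)
  also have "(\<Sum>a\<in>insert None (Some ` L). if a = None then 1 - q else q / card L) = 1"
    using L(1) cL by (subst sum.insert) (auto simp: sum.reindex)
  also have "(\<Sum>b\<in>UNIV. if b then 1 - q else q) = 1"
    by (simp add: UNIV_bool)
  finally have sum\<rho>: "sum \<rho> ?A = 1" by simp
  have finA: "finite ?A" using L(1) by simp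
  have codeV: "code s \<in> ?VE" for s
    using L(2) by (auto simp: code_def image_subset_iff)
  \<comment> \<open>A matched symbol is read off the window of \<open>w'\<close>, an unmatched one
    off the code. For \<open>s \<notin> D\<close> the code spells out the whole window, so the
    arbitrary value of \<open>\<sigma> s\<close> does no harm.\<close>
  have det: "window m w s = window m w s'"
    if Y: "window m w' (\<sigma> s) = window m w' (\<sigma> s')" and C: "code s = code s'" for s s'
  proof (rule nth_equalityI)
    have nth: "(j \<in> matched m s \<longleftrightarrow> j \<in> matched m s') \<and> (j \<notin> matched m s \<longrightarrow> w (s + j) = w (s' + j))
       \<and> (j \<in> shift s ` matched m s \<longleftrightarrow> j \<in> shift s' ` matched m s')" if "j < m" for j
      using arg_cong[OF C, of "\<lambda>c. c ! j"] that by (auto simp: code_def split: if_splits)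
    have M: "matched m s = matched m s'"
      using nth matched_subset by blast
    have F: "shift s ` matched m s = shift s' ` matched m s'"
      using nth shift_subset by blast
    fix j assume "j < length (window m w s)"
    then have j: "j < m" by simp
    show "window m w s ! j = window m w s' ! j"
    proof (cases "j \<in> matched m s")
      case True
      have sh: "shift s j = shift s' j"
        using mono_bij_unique[OF finite_matched shift_bij[of s m] shift_mono[of m s], of "shift s'" j]
          shift_bij[of s' m] shift_mono[of m s'] True M F by auto
      have T': "j \<in> matched m s'" using True M by simp
      have "w (s + j) = window m w' (\<sigma> s) ! shift s j"
        using matchedD[OF True] agree \<sigma>(2) by simp
      moreover have "w (s' + j) = window m w' (\<sigma> s') ! shift s' j"
        using matchedD[OF T'] agree \<sigma>(2) by simp
      ultimately show ?thesis using Y sh j by simp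
    qed (use nth j in simp)
  qed simp
  have cost: "- ln (?r (code s)) \<le> 2 * card ({..<m} - matched m s) * ln (card L / q) - 2 * m * ln (1 - q)" for s
  proof -
    let ?e = "\<lambda>j. (if j \<in> matched m s then None else Some (w (s + j)), j \<in> shift s ` matched m s)"
    have "- ln (?r (code s)) = (\<Sum>j<m. - ln (\<rho> (?e j)))"
      using ln_prod_list[of "map \<rho> (code s)"] \<rho>pos
      by (auto simp: code_def comp_def sum_negf interv_sum_list_conv_sum_set_nat atLeast0LessThan)
    also have "\<dots> \<le> (\<Sum>j<m. (if j \<notin> matched m s then ln (card L / q) else 0)
        + (if j \<notin> shift s ` matched m s then ln (card L / q) else 0) - 2 * ln (1 - q))"
    proof (rule sum_mono)
      fix j
      let ?x = "if j \<in> matched m s then 1 - q else q / card L"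
      let ?y = "if j \<in> shift s ` matched m s then 1 - q else q"
      have "- ln (q / card L) = ln (card L / q)" "- ln q = ln (1 / q)"
        using q cL by (simp_all add: ln_div)
      moreover have "ln (1 - q) \<le> 0" using q by simp
      ultimately have "- ln ?x \<le> (if j \<notin> matched m s then ln (card L / q) else 0) - ln (1 - q)"
        "- ln ?y \<le> (if j \<notin> shift s ` matched m s then ln (card L / q) else 0) - ln (1 - q)"
        using lam by (simp_all only: split: if_split) linarith+
      moreover have "\<rho> (?e j) = ?x * ?y" "0 < ?x" "0 < ?y"
        using q cL by (simp_all add: \<rho>_def)
      then have "ln (\<rho> (?e j)) = ln ?x + ln ?y"
        by (simp only: ln_mult_pos)
      ultimately show "- ln (\<rho> (?e j)) \<le> (if j \<notin> matched m s then ln (card L / q) else 0)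
        + (if j \<notin> shift s ` matched m s then ln (card L / q) else 0) - 2 * ln (1 - q)"
        by linarith
    qed
    also have "\<dots> = card ({..<m} - matched m s) * ln (card L / q)
        + card ({..<m} - shift s ` matched m s) * ln (card L / q) - 2 * m * ln (1 - q)"
      by (simp add: sum.distrib sum_subtractf sum.If_cases Diff_eq Compl_eq Int_def)
    finally show ?thesis
      by (simp add: card_unmatched_shift mult_ac)
  qed
  have "shannon V (push ?J ?p (window m w))
      \<le> shannon V (push ?J ?p (\<lambda>s. window m w' (\<sigma> s))) + (\<Sum>s\<in>?J. ?p s * - ln (?r (code s)))"
  proof (rule gibbs[where VE = ?VE])
    show "finite V" "finite V" "finite ?VE"
      using L finA unfolding V_def by (simp_all add: finite_lists_length_eq)
    show "window m w ` ?J \<subseteq> V" "(\<lambda>s. window m w' (\<sigma> s)) ` ?J \<subseteq> V"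
      using window_in L unfolding V_def by blast+
    show "code ` ?J \<subseteq> ?VE" using codeV by blast
    show "sum ?r ?VE \<le> 1"
      using sum_prod_list[OF finA, of \<rho> m] sum\<rho> by simp
    show "0 < ?r (code j)" for j by (rule rpos)
    show "0 \<le> ?r e" for e using rpos[of e] by simp
    show "sum ?p ?J = 1" using N by simp
    show "window m w i = window m w j"
      if "window m w' (\<sigma> i) = window m w' (\<sigma> j)" "code i = code j" for i j
      using that by (rule det)
  qed simp_all
  also have "push ?J ?p (\<lambda>s. window m w' (\<sigma> s)) = push ?J ?p (window m w')"
  proof
    fix v
    have "(\<Sum>j\<in>?J. if window m w' (\<sigma> j) = v then 1 / real N else 0)
        = (\<Sum>j\<in>?J. if window m w' j = v then 1 / real N else 0)"
      using \<sigma>(1) by (rule sum.reindex_bij_betw)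
    then show "push ?J ?p (\<lambda>s. window m w' (\<sigma> s)) v = push ?J ?p (window m w') v"
      unfolding push_def by (simp only: sum.inter_filter finite_lessThan)
  qed
  also have "(\<Sum>s\<in>?J. ?p s * - ln (?r (code s)))
      \<le> (\<Sum>s\<in>?J. ?p s * (2 * card ({..<m} - matched m s) * ln (card L / q) - 2 * m * ln (1 - q)))"
    using cost by (intro sum_mono mult_left_mono) auto
  also have "\<dots> = 2 * (real (\<Sum>s<N. card ({..<m} - matched m s)) / N) * ln (card L / q) - 2 * m * ln (1 - q)"
  proof -
    have "(\<Sum>s\<in>?J. ?p s * (2 * card ({..<m} - matched m s) * ln (card L / q) - 2 * m * ln (1 - q)))
        = (\<Sum>s\<in>?J. 2 * ln (card L / q) / N * card ({..<m} - matched m s)) - (\<Sum>s\<in>?J. 2 * m * ln (1 - q) / N)"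
      unfolding sum_subtractf[symmetric] by (intro sum.cong refl) (simp add: diff_divide_distrib)
    also have "(\<Sum>s\<in>?J. 2 * ln (card L / q) / N * card ({..<m} - matched m s))
        = 2 * ln (card L / q) / N * real (\<Sum>s<N. card ({..<m} - matched m s))"
      by (simp only: sum_distrib_left[symmetric] of_nat_sum)
    finally show ?thesis
      using N by simp
  qed
  also have "2 * (real (\<Sum>s<N. card ({..<m} - matched m s)) / N) * ln (card L / q)
      \<le> 2 * (real (3 * m * (N - card D) + 2 * m\<^sup>2) / real N) * ln (card L / q)"
    using sum_unmatched_le[of m] lam(1)
    by (intro mult_right_mono mult_left_mono divide_right_mono iffD2[OF of_nat_le_iff]) simp_all
  finally show ?thesis by simp
qed

end

section \<open>Entropy of labellings\<close>

lemma fekete: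
  fixes a :: "nat \<Rightarrow> real"
  assumes nonneg: "\<And>n. 0 \<le> a n" and sub: "\<And>m n. a (m + n) \<le> a m + a n"
  shows "convergent (\<lambda>n. a n / real n)"
proof -
  \<comment> \<open>The infimum starts at 1: at \<open>n = 0\<close> the quotient is 0 by the
    convention on division and would spoil it.\<close>
  define l where "l = (INF n\<in>{1..}. a n / real n)"
  have bdd: "bdd_below ((\<lambda>n. a n / real n) ` {1..})"
    using nonneg by (intro bdd_belowI2[of _ 0]) auto
  have lower: "l \<le> a n / real n" if "1 \<le> n" for n
    unfolding l_def using bdd that by (intro cINF_lower) auto
  have mult: "a (k * m + r) \<le> real k * a m + a r" for k m r
  proof (induction k)
    case (Suc k)
    then show ?case
      using sub[of m "k * m + r"] by (simp add: algebra_simps)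
  qed simp
  have "(\<lambda>n. a n / real n) \<longlonglongrightarrow> l"
  proof (rule LIMSEQ_I)
    fix e :: real assume e: "0 < e"
    then have "\<exists>m\<in>{1..}. a m / real m < l + e / 2"
      using cINF_less_iff[OF _ bdd, of "l + e / 2"] by (simp add: l_def)
    then obtain m where m: "1 \<le> m" "a m / real m < l + e / 2" by auto
    \<comment> \<open>A bound for the remainder \<open>a (n mod m)\<close> independent of
      \<open>n\<close>, so that its share \<open>B / n\<close> drops below
      \<open>e / 2\<close>.\<close>
    define B where "B = (\<Sum>r<m. a r)"
    have B: "a r \<le> B" if "r < m" for r
      unfolding B_def using nonneg that by (intro member_le_sum) auto
    obtain n0 where n0: "2 * B / e < real n0" using reals_Archimedean2 by blast
    show "\<exists>no. \<forall>n\<ge>no. norm (a n / real n - l) < e"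
    proof (intro exI[of _ "max 1 n0"] allI impI)
      fix n assume n: "max 1 n0 \<le> n"
      have "a n \<le> real (n div m) * a m + a (n mod m)"
        using mult[of "n div m" m "n mod m"] by simp
      also have "\<dots> \<le> real n / real m * a m + B"
        using nonneg[of m] B[of "n mod m"] m(1) of_nat_div_le_of_nat[of n m]
        by (intro add_mono mult_right_mono) auto
      finally have "a n / real n \<le> (real n / real m * a m + B) / real n"
        by (rule divide_right_mono) simp
      also have "\<dots> = a m / real m + B / real n"
        using n by (simp add: add_divide_distrib)
      finally have "a n / real n \<le> a m / real m + B / real n" .
      moreover have "B / real n < e / 2"
      proof -
        have "2 * B / e < real n" using n0 n by linarith
        then have "2 * B < real n * e" using e by (simp add: pos_divide_less_eq)
        then show ?thesis using n by (simp add: pos_divide_less_eq mult.commute)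
      qed
      moreover have "l \<le> a n / real n"
        using lower n by simp
      ultimately have "\<bar>a n / real n - l\<bar> < e"
        using m(2) e by linarith
      then show "norm (a n / real n - l) < e" by simp
    qed
  qed
  then show ?thesis by (rule convergentI)
qed

section \<open>Finite Borel labellings and their itineraries\<close>

definition simple :: "('a::topological_space \<Rightarrow> 'b) \<Rightarrow> bool" where
  "simple f \<longleftrightarrow> finite (range f) \<and> (\<forall>v. f -` {v} \<in> sets borel)"

definition law :: "'a measure \<Rightarrow> ('a \<Rightarrow> 'b) \<Rightarrow> 'b \<Rightarrow> real" where
  "law M f v = measure M (f -` {v})"

definition ent :: "'a measure \<Rightarrow> ('a \<Rightarrow> 'b) \<Rightarrow> real" where
  "ent M f = shannon (range f) (law M f)"

text \<open>The itinerary along the true orbit of \<open>x\<close>, whereas \<open>window\<close>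
  reads labels along an arbitrary sequence.\<close>

definition name :: "('a \<Rightarrow> 'a) \<Rightarrow> ('a \<Rightarrow> 'b) \<Rightarrow> nat \<Rightarrow> 'a \<Rightarrow> 'b list" where
  "name T c m x = map (\<lambda>i. c ((T ^^ i) x)) [0..<m]"

lemma simple_vimage: "simple f \<Longrightarrow> f -` S \<in> sets borel"
proof -
  assume f: "simple f"
  have "f -` S = (\<Union>v\<in>range f \<inter> S. f -` {v})" by auto
  also have "\<dots> \<in> sets borel"
    using f by (intro sets.finite_UN) (auto simp: simple_def)
  finally show ?thesis .
qed

lemma simple_comp: "simple f \<Longrightarrow> simple (\<lambda>x. g (f x))"
proof -
  assume f: "simple f"
  have "(\<lambda>x. g (f x)) -` {v} = f -` (g -` {v})" for v by auto
  moreover have "range (\<lambda>x. g (f x)) = g ` range f" by auto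
  ultimately show ?thesis
    using f simple_vimage[OF f] by (simp add: simple_def)
qed

lemma simple_Pair: "simple f \<Longrightarrow> simple g \<Longrightarrow> simple (\<lambda>x. (f x, g x))"
proof -
  assume fg: "simple f" "simple g"
  have "(\<lambda>x. (f x, g x)) -` {v} = f -` {fst v} \<inter> g -` {snd v}" for v by (cases v) auto
  moreover have "range (\<lambda>x. (f x, g x)) \<subseteq> range f \<times> range g" by auto
  ultimately show ?thesis
    using fg finite_subset[of _ "range f \<times> range g"] by (auto simp: simple_def)
qed

lemma length_name [simp]: "length (name T c m x) = m"
  by (simp add: name_def)

lemma nth_name [simp]: "j < m \<Longrightarrow> name T c m x ! j = c ((T ^^ j) x)"
  by (simp add: name_def)

lemma name_eq_iff: "name T c m x = name T c m y \<longleftrightarrow> (\<forall>i<m. c ((T ^^ i) x) = c ((T ^^ i) y))"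
  by (auto simp: list_eq_iff_nth_eq)

lemma name_in: "range c \<subseteq> L \<Longrightarrow> name T c m x \<in> {xs. set xs \<subseteq> L \<and> length xs = m}"
  by (auto simp: name_def)

lemma take_name: "take m (name T c (m + n) x) = name T c m x"
  by (rule nth_equalityI) auto

lemma drop_name: "drop m (name T c (m + n) x) = name T c n ((T ^^ m) x)"
  by (rule nth_equalityI) (simp_all add: funpow_add add.commute)

text \<open>The bridge from labellings to partitions. Labellings are preferred because words of
  labels can be compared between two sequences and two measures. Only attained labels contribute, so
  no cell is empty, in line with \<open>iterated_join\<close>.\<close>

definition fibres :: "('a \<Rightarrow> 'b) \<Rightarrow> 'a set set" where
  "fibres c = range (\<lambda>x. c -` {c x})"

lemma fibres_image: "fibres c = (\<lambda>v. c -` {v}) ` range c"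
  by (simp add: fibres_def image_image)

lemma fibres_meas_partition:
  assumes "simple c" "space M = UNIV" "sets M = sets borel"
  shows "finite_meas_partition M (fibres c)"
  unfolding finite_meas_partition_def
proof (intro conjI)
  show "finite (fibres c)"
    using assms(1) by (simp add: simple_def fibres_image)
  show "fibres c \<subseteq> sets M"
    using assms(1,3) by (auto simp: simple_def fibres_def)
  show "partition_on (space M) (fibres c)"
    unfolding assms(2) by (rule partition_onI) (auto simp: fibres_def disjnt_def)
qed

text \<open>A nonempty cell of the join contains some \<open>x\<close>, and then its
  \<open>i\<close>-th factor can only be the fibre of \<open>c\<close> through
  \<open>(T ^^ i) x\<close>; the cell is thus the set of points sharing the itinerary of
  \<open>x\<close>.\<close>

lemma iterated_join_fibres: "iterated_join T (fibres c) m = fibres (name T c m)"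
proof -
  have fib: "name T c m -` {name T c m x} = (\<Inter>i\<in>{..<m}. (T ^^ i) -` (c -` {c ((T ^^ i) x)}))" for x
    by (rule set_eqI) (simp add: name_eq_iff, blast)
  show ?thesis
  proof (intro equalityI subsetI)
    fix C assume "C \<in> iterated_join T (fibres c) m"
    then obtain A where A: "\<forall>i<m. A i \<in> fibres c" and C: "C = (\<Inter>i\<in>{..<m}. (T ^^ i) -` A i)" "C \<noteq> {}"
      unfolding iterated_join_def by blast
    then obtain x where x: "x \<in> C" by blast
    have A_eq: "A i = c -` {c ((T ^^ i) x)}" if i: "i < m" for i
    proof -
      obtain y where "A i = c -` {c y}" using A i unfolding fibres_def by blast
      moreover have "(T ^^ i) x \<in> A i" using x i C(1) by blast
      ultimately show ?thesis by simp
    qed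
    have "C = name T c m -` {name T c m x}"
      unfolding fib C(1) by (intro INF_cong refl) (simp add: A_eq)
    then show "C \<in> fibres (name T c m)" unfolding fibres_def by blast
  next
    fix C assume "C \<in> fibres (name T c m)"
    then obtain x where C: "C = name T c m -` {name T c m x}" unfolding fibres_def by blast
    then have "x \<in> C" by simp
    moreover have "\<forall>i<m. c -` {c ((T ^^ i) x)} \<in> fibres c" by (simp add: fibres_def)
    moreover have "C = (\<Inter>i\<in>{..<m}. (T ^^ i) -` (c -` {c ((T ^^ i) x)}))"
      unfolding C by (rule fib)
    ultimately show "C \<in> iterated_join T (fibres c) m"
      unfolding iterated_join_def
      by (intro DiffI CollectI exI[of _ "\<lambda>i. c -` {c ((T ^^ i) x)}"] conjI) auto
  qed
qed

lemma partition_entropy_fibres: "partition_entropy M (fibres f) = ent M f"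
proof -
  have "inj_on (\<lambda>v. f -` {v}) (range f)" by (auto simp: inj_on_def)
  then show ?thesis
    unfolding partition_entropy_def ent_def shannon_def law_def fibres_image
    by (subst sum.reindex) simp_all
qed

lemma entropy_wrt_fibres:
  "entropy_wrt T M (fibres c) = lim (\<lambda>m. ent M (name T c m) / real m)"
  by (simp add: entropy_wrt_def iterated_join_fibres partition_entropy_fibres)

section \<open>Laws and entropies of labellings\<close>

locale borel_prob = prob_space M for M :: "'a::topological_space measure" +
  assumes sets_M: "sets M = sets borel"
begin

lemma space_M [simp]: "space M = UNIV"
  using sets_eq_imp_space_eq[OF sets_M] by simp

lemma law_comp:
  assumes f: "simple f"
  shows "law M (\<lambda>x. g (f x)) = push (range f) (law M f) g"
proof
  fix v
  have "(\<lambda>x. g (f x)) -` {v} = (\<Union>u\<in>{u\<in>range f. g u = v}. f -` {u})" by auto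
  moreover have "measure M (\<Union>u\<in>{u\<in>range f. g u = v}. f -` {u}) = (\<Sum>u\<in>{u\<in>range f. g u = v}. measure M (f -` {u}))"
    using f by (intro finite_measure_finite_Union) (auto simp: simple_def sets_M disjoint_family_on_def)
  ultimately show "law M (\<lambda>x. g (f x)) v = push (range f) (law M f) g v"
    by (simp add: law_def push_def)
qed

lemma law_nonneg: "0 \<le> law M f v"
  by (simp add: law_def)

lemma law_outside: "v \<notin> range f \<Longrightarrow> law M f v = 0"
proof -
  assume "v \<notin> range f"
  then have "f -` {v} = {}" by auto
  then show ?thesis by (simp add: law_def)
qed

lemma ent_eq_shannon:
  assumes "finite V" "range f \<subseteq> V"
  shows "ent M f = shannon V (law M f)"
  unfolding ent_def using assms law_outside
  by (intro shannon_le_superset[symmetric]) auto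

lemma sum_law:
  assumes f: "simple f"
  shows "sum (law M f) (range f) = 1"
proof -
  have "law M (\<lambda>x. ()) () = push (range f) (law M f) (\<lambda>_. ()) ()"
    using law_comp[OF f, of "\<lambda>_. ()"] by simp
  moreover have "measure M UNIV = 1"
    using prob_space by simp
  ultimately show ?thesis
    by (simp add: law_def push_def vimage_const)
qed

lemma sum_law_if:
  assumes f: "simple f"
  shows "(\<Sum>v\<in>range f. law M f v * (if Q v then a else 0)) = measure M {x. Q (f x)} * a"
proof -
  have "(\<Sum>v\<in>range f. law M f v * (if Q v then a else 0))
      = (\<Sum>v\<in>{v\<in>range f. Q v = True}. law M f v) * a"
    using f unfolding sum_distrib_right
    by (subst sum.inter_filter) (auto simp: simple_def intro!: sum.cong)
  also have "(\<Sum>v\<in>{v\<in>range f. Q v = True}. law M f v) = law M (\<lambda>x. Q (f x)) True"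
    by (simp add: law_comp[OF f] push_def)
  finally show ?thesis
    by (simp add: law_def vimage_def)
qed

lemma ent_nonneg: "0 \<le> ent M f"
proof -
  have "law M f v * ln (law M f v) \<le> 0" for v
  proof (cases "law M f v = 0")
    case False
    then have "0 < law M f v" "law M f v \<le> 1"
      using prob_le_1 by (auto simp: law_def zero_less_measure_iff)
    then show ?thesis by (simp add: mult_le_0_iff)
  qed simp
  then show ?thesis
    by (simp add: ent_def shannon_def sum_nonpos)
qed

text \<open>All variables factor through one simple map \<open>f\<close>, so its finite range with
  the law of \<open>f\<close> can serve as the sample space \<open>J\<close> of
  \<open>gibbs\<close>.\<close>

lemma ent_gibbs:
  assumes f: "simple f" and VE: "finite VE" "\<And>x. e (f x) \<in> VE"
    and r: "\<And>v. v \<in> VE \<Longrightarrow> 0 \<le> r v" "sum r VE \<le> 1" "\<And>x. 0 < law M f (f x) \<Longrightarrow> 0 < r (e (f x))"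
    and det: "\<And>x y. k (f x) = k (f y) \<Longrightarrow> e (f x) = e (f y) \<Longrightarrow> g (f x) = g (f y)"
  shows "ent M (\<lambda>x. g (f x)) \<le> ent M (\<lambda>x. k (f x)) + (\<Sum>v\<in>range f. law M f v * - ln (r (e v)))"
proof -
  have fin: "finite (range f)" using f by (simp add: simple_def)
  have "shannon (range (\<lambda>x. g (f x))) (push (range f) (law M f) g)
    \<le> shannon (range (\<lambda>x. k (f x))) (push (range f) (law M f) k)
      + (\<Sum>v\<in>range f. law M f v * - ln (r (e v)))"
  proof (rule gibbs[where VE = VE])
    show "finite (range (\<lambda>x. g (f x)))" "finite (range (\<lambda>x. k (f x)))"
      using simple_comp[OF f] by (auto simp: simple_def)
    show "sum (law M f) (range f) = 1" by (rule sum_law[OF f])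
    show "0 < r (e j)" if "j \<in> range f" "0 < law M f j" for j
      using r(3) that by auto
    show "g i = g j" if "i \<in> range f" "j \<in> range f" "k i = k j" "e i = e j" for i j
      using det that by auto
  qed (use fin VE r law_nonneg in auto)
  then show ?thesis
    unfolding ent_def law_comp[OF f] .
qed

end

section \<open>Itineraries under an invariant measure\<close>

locale invariant_system = borel_prob M for M :: "'a::metric_space measure" +
  fixes T :: "'a \<Rightarrow> 'a"
  assumes meas_T: "T \<in> borel_measurable borel" and inv: "distr M borel T = M"
begin

lemma meas_pow: "(T ^^ i) \<in> borel_measurable borel"
proof (induction i)
  case (Suc i)
  then show ?case
    using measurable_comp[OF Suc.IH meas_T] by (simp only: funpow.simps)
qed (simp add: id_def)

lemma vimage_pow: "A \<in> sets borel \<Longrightarrow> (T ^^ i) -` A \<in> sets borel"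
  using measurable_sets[OF meas_pow[of i], of A] by simp

lemma measure_pow:
  assumes "A \<in> sets borel"
  shows "measure M ((T ^^ i) -` A) = measure M A"
  using assms
proof (induction i arbitrary: A)
  case (Suc i)
  have "T \<in> measurable M borel"
    using meas_T sets_M by (simp cong: measurable_cong_sets)
  then have "measure M A = measure M (T -` A)"
    using Suc.prems measure_distr[of T M borel A] inv by simp
  moreover have "T -` A \<in> sets borel"
    using measurable_sets[OF meas_T Suc.prems] by simp
  moreover have "(T ^^ Suc i) -` A = (T ^^ i) -` (T -` A)"
    by (auto simp: funpow_swap1)
  ultimately show ?case
    using Suc.IH by (simp del: funpow.simps)
qed simp

lemma simple_pow: "simple c \<Longrightarrow> simple (\<lambda>x. c ((T ^^ i) x))"
proof -
  assume c: "simple c"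
  have "(\<lambda>x. c ((T ^^ i) x)) -` {v} = (T ^^ i) -` (c -` {v})" for v by auto
  moreover have "range (\<lambda>x. c ((T ^^ i) x)) \<subseteq> range c" by auto
  ultimately show ?thesis
    using c vimage_pow finite_subset[of _ "range c"] by (simp add: simple_def)
qed

lemma law_pow: "simple c \<Longrightarrow> law M (\<lambda>x. c ((T ^^ i) x)) = law M c"
proof
  fix v assume "simple c"
  then have "measure M ((T ^^ i) -` (c -` {v})) = measure M (c -` {v})"
    by (intro measure_pow) (simp add: simple_def)
  moreover have "(\<lambda>x. c ((T ^^ i) x)) -` {v} = (T ^^ i) -` (c -` {v})" by auto
  ultimately show "law M (\<lambda>x. c ((T ^^ i) x)) v = law M c v"
    by (simp add: law_def)
qed

lemma simple_name: "simple c \<Longrightarrow> simple (name T c m)"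
proof (induction m)
  case 0
  have "name T c 0 = (\<lambda>_. [])" by (auto simp: name_def)
  then show ?case by (simp add: simple_def vimage_const)
next
  case (Suc m)
  have "name T c (Suc m) = (\<lambda>x. (\<lambda>(u, v). u @ [v]) (name T c m x, c ((T ^^ m) x)))"
    by (auto simp: name_def)
  then show ?case
    using simple_comp[OF simple_Pair[OF Suc.IH simple_pow[of c m]], of "\<lambda>(u, v). u @ [v]"] Suc.prems
    by simp
qed

text \<open>The prefix of length \<open>m\<close> plays \<open>Y\<close> and the suffix plays
  \<open>E\<close>. By invariance the suffix is distributed as the itinerary of length
  \<open>n\<close>; taking that law for \<open>r\<close> turns the cross-entropy into its
  entropy.\<close>

lemma ent_name_subadditive:
  assumes c: "simple c"
  shows "ent M (name T c (m + n)) \<le> ent M (name T c m) + ent M (name T c n)"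
proof -
  let ?f = "name T c (m + n)"
  have f: "simple ?f" and n: "simple (name T c n)" using simple_name[OF c] by auto
  have law_n: "law M (name T c n) = push (range ?f) (law M ?f) (drop m)"
    using law_comp[OF f, of "drop m"] law_pow[OF n, of m] by (simp add: drop_name)
  have fin: "finite (range ?f)" "finite (range (name T c n))"
    using f n by (auto simp: simple_def)
  have "ent M (\<lambda>x. id (?f x)) \<le> ent M (\<lambda>x. take m (?f x))
      + (\<Sum>v\<in>range ?f. law M ?f v * - ln (law M (name T c n) (drop m v)))"
  proof (rule ent_gibbs[OF f fin(2)])
    show "drop m (?f x) \<in> range (name T c n)" for x
      by (simp add: drop_name)
    show "sum (law M (name T c n)) (range (name T c n)) \<le> 1"
      using sum_law[OF n] by simp
    show "0 < law M (name T c n) (drop m (?f x))" if "0 < law M ?f (?f x)" for x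
      using push_ge[of "range ?f" "law M ?f" "?f x" "drop m"] that fin law_nonneg law_n by fastforce
    show "id (?f x) = id (?f y)" if "take m (?f x) = take m (?f y)" "drop m (?f x) = drop m (?f y)" for x y
      using that by (metis append_take_drop_id)
  qed (rule law_nonneg)
  also have "(\<Sum>v\<in>range ?f. law M ?f v * - ln (law M (name T c n) (drop m v))) = ent M (name T c n)"
    unfolding ent_def unfolding law_n using fin
    by (subst shannon_push) (auto simp: sum_negf drop_name)
  finally show ?thesis
    by (simp add: take_name)
qed

lemma entropy_limit:
  assumes "simple c"
  shows "(\<lambda>m. ent M (name T c m) / real m) \<longlonglongrightarrow> entropy_wrt T M (fibres c)"
  unfolding entropy_wrt_fibres
  unfolding convergent_LIMSEQ_iff[symmetric]
  by (rule fekete) (simp_all add: ent_nonneg ent_name_subadditive[OF assms])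

text \<open>The itinerary for \<open>c0\<close> is recovered from that for \<open>c\<close> and a
  word of corrections, which shows \<open>None\<close> where \<open>c\<close> is right and the true
  symbol elsewhere. By invariance each position is wrong with probability at most
  \<open>\<eta>\<close>, so the expected cost is linear in \<open>m\<close>.\<close>

lemma ent_name_approx:
  fixes c0 :: "'a \<Rightarrow> 'b" and c :: "'a \<Rightarrow> 'b option"
  assumes c0: "simple c0" and c: "simple c" and L: "finite L" "range c0 \<subseteq> L"
    and q: "0 < q" "q < 1" and close: "measure M {x. c x \<noteq> Some (c0 x)} \<le> \<eta>"
  shows "ent M (name T c0 m) \<le> ent M (name T c m) + m * (\<eta> * ln (card L / q) - ln (1 - q))"
proof -
  let ?f = "\<lambda>x. (name T c0 m x, name T c m x)"
  let ?e1 = "\<lambda>(a :: 'b) b. if b = Some a then None else Some a"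
  define e where "e = (\<lambda>(u, v). map2 ?e1 u v)"
  let ?A = "insert None (Some ` L)"
  let ?VE = "{xs. set xs \<subseteq> ?A \<and> length xs = m}"
  define \<rho> where "\<rho> = (\<lambda>a :: 'b option. if a = None then 1 - q else q / card L)"
  have f: "simple ?f" using c0 c by (intro simple_Pair simple_name)
  have "L \<noteq> {}" using L(2) by auto
  then have cL: "1 \<le> real (card L)"
    using L(1) by (simp add: Suc_le_eq card_gt_0_iff)
  have \<rho>pos: "0 < \<rho> a" for a using q cL by (simp add: \<rho>_def)
  have rpos: "0 < prod_list (map \<rho> es)" for es
    by (induction es) (simp_all add: \<rho>pos)
  have ln_code: "- ln (prod_list (map \<rho> es)) = (\<Sum>j<length es. - ln (\<rho> (es ! j)))" for es
  proof -
    have "ln (prod_list (map \<rho> es)) = sum_list (map ln (map \<rho> es))"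
      using ln_prod_list[of "map \<rho> es"] \<rho>pos by fastforce
    also have "\<dots> = (\<Sum>j<length es. ln (\<rho> (es ! j)))"
      by (simp add: sum_list_sum_nth atLeast0LessThan)
    finally show ?thesis by (simp add: sum_negf)
  qed
  have sum\<rho>: "sum \<rho> ?A = 1"
    unfolding \<rho>_def using L(1) cL by (subst sum.insert) (auto simp: sum.reindex)
  have nth_e: "e (?f x) ! j = ?e1 (c0 ((T ^^ j) x)) (c ((T ^^ j) x))" if "j < m" for x j
    using that by (simp add: e_def)
  have len_e: "length (e (?f x)) = m" for x by (simp add: e_def)
  have lam: "0 \<le> ln (card L / q)"
    using q cL by simp
  have "ent M (\<lambda>x. fst (?f x)) \<le> ent M (\<lambda>x. snd (?f x))
      + (\<Sum>v\<in>range ?f. law M ?f v * - ln (prod_list (map \<rho> (e v))))"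
  proof (rule ent_gibbs[OF f, where VE = ?VE and g = fst and k = snd and e = e
        and r = "\<lambda>es. prod_list (map \<rho> es)"])
    show "finite ?VE" using L(1) by (intro finite_lists_length_eq) simp
    show "e (?f x) \<in> ?VE" for x
    proof -
      have "e (?f x) ! j \<in> ?A" if "j < m" for j
        using L(2) unfolding nth_e[OF that] by auto
      then show ?thesis
        using len_e[of x] by (auto simp: set_conv_nth)
    qed
    show "0 \<le> prod_list (map \<rho> v)" for v using rpos[of v] by simp
    show "sum (\<lambda>e. prod_list (map \<rho> e)) ?VE \<le> 1"
      using sum_prod_list[of ?A \<rho> m] L(1) sum\<rho> by simp
    show "fst (?f x) = fst (?f y)" if Y: "snd (?f x) = snd (?f y)" and E: "e (?f x) = e (?f y)" for x y
    proof -
      have "c0 ((T ^^ j) x) = c0 ((T ^^ j) y)" if "j < m" for j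
      proof -
        have "c ((T ^^ j) x) = c ((T ^^ j) y)"
          using Y that by (simp add: name_eq_iff)
        moreover have "?e1 (c0 ((T ^^ j) x)) (c ((T ^^ j) x)) = ?e1 (c0 ((T ^^ j) y)) (c ((T ^^ j) y))"
          unfolding nth_e[OF that, symmetric] E ..
        ultimately show ?thesis by (auto split: if_splits)
      qed
      then show ?thesis by (simp add: name_eq_iff)
    qed
  qed (rule rpos)
  also have "(\<Sum>v\<in>range ?f. law M ?f v * - ln (prod_list (map \<rho> (e v))))
      \<le> (\<Sum>v\<in>range ?f. law M ?f v *
          (\<Sum>j<m. (if snd v ! j \<noteq> Some (fst v ! j) then ln (card L / q) else 0) - ln (1 - q)))"
  proof (intro sum_mono mult_left_mono)
    fix v assume "v \<in> range ?f"
    then obtain x where x: "v = ?f x" by auto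
    have "- ln (prod_list (map \<rho> (e v))) = (\<Sum>j<m. - ln (\<rho> (e v ! j)))"
      unfolding ln_code x len_e ..
    also have "\<dots> \<le> (\<Sum>j<m. (if snd v ! j \<noteq> Some (fst v ! j) then ln (card L / q) else 0) - ln (1 - q))"
    proof (rule sum_mono)
      fix j assume "j \<in> {..<m}"
      then have ej: "e v ! j = ?e1 (fst v ! j) (snd v ! j)"
        using nth_e[of j x] unfolding x by simp
      have "ln (q / card L) = - ln (card L / q)" "ln (1 - q) \<le> 0"
        using q cL by (simp_all add: ln_div)
      then show "- ln (\<rho> (e v ! j)) \<le> (if snd v ! j \<noteq> Some (fst v ! j) then ln (card L / q) else 0) - ln (1 - q)"
        unfolding ej \<rho>_def by simp
    qed
    finally show "- ln (prod_list (map \<rho> (e v)))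
       \<le> (\<Sum>j<m. (if snd v ! j \<noteq> Some (fst v ! j) then ln (card L / q) else 0) - ln (1 - q))" .
  qed (rule law_nonneg)
  also have "\<dots> = (\<Sum>j<m. \<Sum>v\<in>range ?f. law M ?f v *
       ((if snd v ! j \<noteq> Some (fst v ! j) then ln (card L / q) else 0) - ln (1 - q)))"
    by (simp only: sum_distrib_left) (rule sum.swap)
  also have "\<dots> \<le> (\<Sum>j<m. \<eta> * ln (card L / q) - ln (1 - q))"
  proof (rule sum_mono)
    fix j assume j: "j \<in> {..<m}"
    let ?B = "{x. c x \<noteq> Some (c0 x)}"
    have B: "?B \<in> sets borel"
      using simple_vimage[OF simple_Pair[OF c c0], of "{(u, v). u \<noteq> Some v}"] by (simp add: vimage_def)
    have "(\<Sum>v\<in>range ?f. law M ?f v *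
       ((if snd v ! j \<noteq> Some (fst v ! j) then ln (card L / q) else 0) - ln (1 - q)))
      = (\<Sum>v\<in>range ?f. law M ?f v * (if snd v ! j \<noteq> Some (fst v ! j) then ln (card L / q) else 0))
        - (\<Sum>v\<in>range ?f. law M ?f v) * ln (1 - q)"
      unfolding right_diff_distrib sum_subtractf sum_distrib_right ..
    also have "\<dots> = measure M {x. snd (?f x) ! j \<noteq> Some (fst (?f x) ! j)} * ln (card L / q) - ln (1 - q)"
      unfolding sum_law_if[OF f, of "\<lambda>v. snd v ! j \<noteq> Some (fst v ! j)"] sum_law[OF f] by simp
    \<comment> \<open>An error at time \<open>j\<close> means that the orbit is in the fixed bad set
      \<open>?B\<close> at time \<open>j\<close>, which makes invariance applicable.\<close>
    also have "{x. snd (?f x) ! j \<noteq> Some (fst (?f x) ! j)} = (T ^^ j) -` ?B"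
      using j by auto
    also have "measure M \<dots> = measure M ?B"
      by (rule measure_pow[OF B])
    also have "\<dots> * ln (card L / q) - ln (1 - q) \<le> \<eta> * ln (card L / q) - ln (1 - q)"
      using mult_right_mono[OF close lam] by simp
    finally show "(\<Sum>v\<in>range ?f. law M ?f v *
       ((if snd v ! j \<noteq> Some (fst v ! j) then ln (card L / q) else 0) - ln (1 - q)))
      \<le> \<eta> * ln (card L / q) - ln (1 - q)" .
  qed
  finally show ?thesis by simp
qed

end

section \<open>Regularity and generic sequences\<close>

locale metric_prob = borel_prob M for M :: "'a::metric_space measure"
begin

text \<open>Continuity from above, as the open neighbourhoods shrink to the closed set
  \<open>F\<close>. Nonemptiness matters: \<open>infdist\<close> to the empty set is 0, which would
  make every neighbourhood the whole space.\<close>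

lemma infdist_neighbourhood_small:
  assumes F: "closed F" "F \<noteq> {}" and e: "0 < e"
  obtains d where "0 < d" "measure M {x. infdist x F < d} < measure M F + e"
proof -
  let ?A = "\<lambda>k::nat. {x. infdist x F < inverse (Suc k)}"
  have "open (?A k)" for k
    by (intro open_Collect_less continuous_intros)
  then have meas: "range ?A \<subseteq> sets M" by (auto simp: sets_M)
  have dec: "decseq ?A"
  proof (unfold decseq_def, intro allI impI Collect_mono)
    fix m n x assume "m \<le> n" "infdist x F < inverse (real (Suc n))"
    moreover have "inverse (real (Suc n)) \<le> inverse (real (Suc m))"
      using \<open>m \<le> n\<close> by (intro le_imp_inverse_le) simp_all
    ultimately show "infdist x F < inverse (real (Suc m))" by linarith
  qed
  have "(\<Inter>k. ?A k) = F"
  proof (intro equalityI subsetI)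
    fix x assume x: "x \<in> (\<Inter>k. ?A k)"
    have "infdist x F \<le> 0"
    proof (rule ccontr)
      assume "\<not> infdist x F \<le> 0"
      then obtain k where "inverse (Suc k) < infdist x F"
        using reals_Archimedean[of "infdist x F"] unfolding not_le by blast
      moreover have "infdist x F < inverse (Suc k)" using x by blast
      ultimately show False by simp
    qed
    then show "x \<in> F"
      using infdist_nonneg[of x F] in_closed_iff_infdist_zero[OF F] by simp
  qed simp
  then have "(\<lambda>k. measure M (?A k)) \<longlonglongrightarrow> measure M F"
    using finite_Lim_measure_decseq[OF meas dec] by simp
  then have "eventually (\<lambda>k. measure M (?A k) < measure M F + e) sequentially"
    using e by (intro order_tendstoD) auto
  then obtain k where "measure M (?A k) < measure M F + e"
    by (auto simp: eventually_sequentially)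
  then show ?thesis by (rule that[rotated]) simp
qed

text \<open>Bounding the single gap \<open>U - F\<close> makes the property symmetric under
  complements, as the induction over Borel sets requires.\<close>

definition regular :: "'a set \<Rightarrow> bool" where
  "regular A \<longleftrightarrow> (\<forall>e>0. \<exists>F U. closed F \<and> open U \<and> F \<subseteq> A \<and> A \<subseteq> U \<and> measure M (U - F) < e)"

lemma regularI:
  assumes "\<And>e. 0 < e \<Longrightarrow> \<exists>F U. closed F \<and> open U \<and> F \<subseteq> A \<and> A \<subseteq> U \<and> measure M (U - F) < e"
  shows "regular A"
  using assms by (simp add: regular_def)

lemma regularE:
  assumes "regular A" "0 < e"
  obtains F U where "closed F" "open U" "F \<subseteq> A" "A \<subseteq> U" "measure M (U - F) < e"
proof -
  have "\<exists>F U. closed F \<and> open U \<and> F \<subseteq> A \<and> A \<subseteq> U \<and> measure M (U - F) < e"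
    using assms unfolding regular_def by (elim allE impE)
  then show thesis using that by (elim exE conjE)
qed

lemma regular_closed:
  assumes "closed F"
  shows "regular F"
proof (cases "F = {}")
  case True
  then show ?thesis
    by (intro regularI exI[of _ "{}"] conjI) simp_all
next
  case False
  show ?thesis
  proof (rule regularI)
    fix e :: real assume "0 < e"
    then obtain d where d: "0 < d" "measure M {x. infdist x F < d} < measure M F + e"
      using infdist_neighbourhood_small[OF assms False] by blast
    let ?U = "{x. infdist x F < d}"
    have U: "open ?U" by (intro open_Collect_less continuous_intros)
    have sub: "F \<subseteq> ?U" using d(1) by auto
    have "measure M (?U - F) = measure M ?U - measure M F"
      using U assms sub by (intro finite_measure_Diff) (auto simp: sets_M)
    then show "\<exists>F' U. closed F' \<and> open U \<and> F' \<subseteq> F \<and> F \<subseteq> U \<and> measure M (U - F') < e"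
      using d(2) U assms sub by (intro exI[of _ F] exI[of _ ?U] conjI) simp_all
  qed
qed

lemma regular_Compl:
  assumes "regular A"
  shows "regular (UNIV - A)"
proof (rule regularI)
  fix e :: real assume "0 < e"
  with assms obtain F U where FU: "closed F" "open U" "F \<subseteq> A" "A \<subseteq> U" "measure M (U - F) < e"
    by (rule regularE)
  have "(UNIV - F) - (UNIV - U) = U - F" by blast
  then have "measure M ((UNIV - F) - (UNIV - U)) < e" using FU(5) by simp
  moreover have "closed (UNIV - U)" "open (UNIV - F)"
    using FU(1,2) by (auto intro: closed_Diff open_Diff)
  moreover have "UNIV - U \<subseteq> UNIV - A" "UNIV - A \<subseteq> UNIV - F"
    using FU(3,4) by auto
  ultimately show "\<exists>F U. closed F \<and> open U \<and> F \<subseteq> UNIV - A \<and> UNIV - A \<subseteq> U \<and> measure M (U - F) < e"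
    by (intro exI[of _ "UNIV - U"] exI[of _ "UNIV - F"] conjI)
qed

text \<open>An infinite union of closed sets need not be closed, so the inner set is a finite
  partial union \<open>G k\<close>. Half of \<open>e\<close> is spent on the gaps
  \<open>U i - F i\<close>, the other half on this truncation.\<close>

lemma regular_Union:
  fixes A :: "nat \<Rightarrow> 'a set"
  assumes "\<And>i. regular (A i)"
  shows "regular (\<Union>i. A i)"
proof (rule regularI)
  fix e :: real assume e: "0 < e"
  define b where "b = (\<lambda>i::nat. e / 2 * (1 / 2) ^ Suc i)"
  have b: "0 < b i" for i using e by (simp add: b_def)
  have sums: "b sums (e / 2)"
    using sums_mult[OF power_half_series, of "e / 2"] by (simp add: b_def)
  have "\<forall>i. \<exists>FU. closed (fst FU) \<and> open (snd FU) \<and> fst FU \<subseteq> A i \<and> A i \<subseteq> snd FU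
      \<and> measure M (snd FU - fst FU) < b i"
  proof
    fix i
    from assms[of i] b[of i] obtain F U where "closed F" "open U" "F \<subseteq> A i" "A i \<subseteq> U"
      "measure M (U - F) < b i"
      by (rule regularE)
    then show "\<exists>FU. closed (fst FU) \<and> open (snd FU) \<and> fst FU \<subseteq> A i \<and> A i \<subseteq> snd FU
      \<and> measure M (snd FU - fst FU) < b i"
      by (intro exI[of _ "(F, U)"]) simp
  qed
  from choice[OF this] obtain FU where FU: "\<forall>i. closed (fst (FU i)) \<and> open (snd (FU i)) \<and> fst (FU i) \<subseteq> A i
      \<and> A i \<subseteq> snd (FU i) \<and> measure M (snd (FU i) - fst (FU i)) < b i"
    by (elim exE)
  define F where "F = (\<lambda>i. fst (FU i))"
  define U where "U = (\<lambda>i. snd (FU i))"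
  have F: "closed (F i)" "F i \<subseteq> A i" and U: "open (U i)" "A i \<subseteq> U i"
    and small: "measure M (U i - F i) < b i" for i
    using FU by (simp_all add: F_def U_def)
  define G where "G = (\<lambda>k. \<Union>i\<le>k. F i)"
  define H where "H = (\<Union>i. F i)"
  define W where "W = (\<Union>i. U i - F i)"
  have clG: "closed (G k)" for k
    unfolding G_def using F(1) by (intro closed_UN) simp_all
  have mG: "G k \<in> sets M" for k using clG by (simp add: sets_M)
  have mUF: "U i - F i \<in> sets M" for i
    using F(1) U(1) by (simp add: sets_M sets.Diff)
  have mH: "H \<in> sets M"
    unfolding H_def using F(1) by (intro sets.countable_UN image_subsetI) (simp add: sets_M)
  have mW: "W \<in> sets M"
    unfolding W_def using mUF by (intro sets.countable_UN image_subsetI)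
  have sub: "G k \<subseteq> H" for k by (auto simp: G_def H_def)
  have Un: "(\<Union>k. G k) = H" by (auto simp: G_def H_def)
  have "(\<lambda>k. measure M (G k)) \<longlonglongrightarrow> measure M (\<Union>k. G k)"
  proof (rule finite_Lim_measure_incseq)
    show "range G \<subseteq> sets M" using mG by (intro image_subsetI)
    show "incseq G" unfolding G_def by (intro incseq_SucI UN_mono) auto
  qed
  then have "eventually (\<lambda>k. measure M H - e / 2 < measure M (G k)) sequentially"
    using e unfolding Un by (intro order_tendstoD(1)[where y = "measure M H"]) simp_all
  then obtain k where k: "measure M H - e / 2 < measure M (G k)"
    unfolding eventually_sequentially by blast
  have summ: "summable (\<lambda>i. measure M (U i - F i))"
  proof (rule summable_comparison_test'[OF sums_summable[OF sums], of 0])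
    show "norm (measure M (U n - F n)) \<le> b n" for n
      using small[of n] by simp
  qed
  have "measure M W \<le> (\<Sum>i. measure M (U i - F i))"
    unfolding W_def using mUF summ by (intro finite_measure_subadditive_countably image_subsetI)
  also have "\<dots> \<le> suminf b"
    using summ sums_summable[OF sums] by (intro suminf_le less_imp_le small)
  also have "\<dots> = e / 2"
    using sums_unique[OF sums] by simp
  finally have 1: "measure M W \<le> e / 2" .
  have "measure M (H - G k) = measure M H - measure M (G k)"
    by (rule finite_measure_Diff[OF mH mG sub])
  then have 2: "measure M (H - G k) < e / 2"
    using k by simp
  have "measure M ((\<Union>i. U i) - G k) \<le> measure M (W \<union> (H - G k))"
    using mW mH mG by (intro finite_measure_mono) (auto simp: W_def H_def)
  also have "\<dots> \<le> measure M W + measure M (H - G k)"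
    using mW mH mG by (intro measure_Un_le) simp_all
  also have "\<dots> < e" using 1 2 by simp
  finally have "measure M ((\<Union>i. U i) - G k) < e" .
  moreover have "G k \<subseteq> (\<Union>i. A i)" using F(2) unfolding G_def by blast
  moreover have "(\<Union>i. A i) \<subseteq> (\<Union>i. U i)" using U(2) by blast
  moreover have "open (\<Union>i. U i)" using U(1) by (intro open_UN) simp
  ultimately show "\<exists>F U. closed F \<and> open U \<and> F \<subseteq> (\<Union>i. A i) \<and> (\<Union>i. A i) \<subseteq> U \<and> measure M (U - F) < e"
    using clG[of k] by (intro exI[of _ "G k"] exI[of _ "\<Union>i. U i"] conjI)
qed

lemma regular_borel: "A \<in> sets borel \<Longrightarrow> regular A"
proof -
  assume "A \<in> sets borel"
  then have "A \<in> sigma_sets UNIV (Collect closed)"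
    by (simp add: borel_eq_closed)
  then show ?thesis
  proof induction
    case (Basic A)
    then show ?case by (simp add: regular_closed)
  next
    case Empty
    then show ?case by (simp add: regular_closed)
  next
    case (Compl A)
    then show ?case by (simp add: regular_Compl)
  next
    case (Union A)
    then show ?case by (simp add: regular_Union)
  qed
qed

lemma closed_inner_approximation:
  assumes "A \<in> sets borel" "0 < e"
  obtains F where "closed F" "F \<subseteq> A" "measure M (A - F) < e"
proof -
  obtain F U where FU: "closed F" "open U" "F \<subseteq> A" "A \<subseteq> U" "measure M (U - F) < e"
    using regular_borel[OF assms(1)] assms(2) by (rule regularE)
  have "measure M (A - F) \<le> measure M (U - F)"
    using FU assms(1) by (intro finite_measure_mono) (auto simp: sets_M)
  then show ?thesis using that FU by auto
qed

text \<open>The closed-set half of the portmanteau theorem: the continuous bump \<open>?f\<close> is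
  1 on \<open>F\<close> and vanishes outside its \<open>d\<close>-neighbourhood, so its averages
  dominate the frequency of \<open>F\<close>.\<close>

lemma generic_closed:
  assumes gen: "generic z M" and F: "closed F" and e: "0 < e"
  shows "eventually (\<lambda>N. real (card {s. s < N \<and> z s \<in> F}) / N < measure M F + e) sequentially"
proof (cases "F = {}")
  case True
  then show ?thesis using e by simp
next
  case False
  obtain d where d: "0 < d" "measure M {x. infdist x F < d} < measure M F + e"
    using infdist_neighbourhood_small[OF F False e] by blast
  let ?f = "\<lambda>x. max 0 (1 - infdist x F / d)"
  let ?U = "{x. infdist x F < d}"
  have cont: "continuous_on UNIV ?f"
    using d(1) by (intro continuous_intros) auto
  have U: "?U \<in> sets M"
    unfolding sets_M by (intro borel_open open_Collect_less continuous_intros)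
  have f: "?f \<in> borel_measurable M"
    using borel_measurable_continuous_onI[OF cont] sets_M by (simp cong: measurable_cong_sets)
  have bound: "0 \<le> ?f x" "?f x \<le> indicator ?U x" for x
    using d(1) infdist_nonneg[of x F] by (auto simp: indicator_def field_simps)
  have "integral\<^sup>L M ?f \<le> integral\<^sup>L M (indicator ?U)"
  proof (rule integral_mono)
    show "integrable M ?f"
      by (rule integrable_const_bound[of _ 1])
        (use f divide_nonneg_pos[OF infdist_nonneg d(1)] in auto)
    show "integrable M (indicator ?U :: 'a \<Rightarrow> real)"
      using U by (simp add: emeasure_eq_measure)
  qed (rule bound)
  also have "\<dots> = measure M ?U" using U by simp
  finally have "integral\<^sup>L M ?f < measure M F + e" using d(2) by simp
  moreover have "(\<lambda>N. integral\<^sup>L (empirical_measure z N) ?f) \<longlonglongrightarrow> integral\<^sup>L M ?f"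
    using gen cont unfolding generic_def weak_star_conv_def by (elim allE impE)
  then have "(\<lambda>N. (\<Sum>j<N. ?f (z j)) / real N) \<longlonglongrightarrow> integral\<^sup>L M ?f"
    unfolding integral_empirical_measure[OF cont] .
  ultimately have "eventually (\<lambda>N. (\<Sum>j<N. ?f (z j)) / real N < measure M F + e) sequentially"
    by (intro order_tendstoD(2))
  then show ?thesis
  proof eventually_elim
    fix N assume N: "(\<Sum>j<N. ?f (z j)) / real N < measure M F + e"
    have "real (card {s. s < N \<and> z s \<in> F}) = (\<Sum>j\<in>{s\<in>{..<N}. z s \<in> F}. 1)"
      by simp
    also have "\<dots> = (\<Sum>j<N. if z j \<in> F then 1 else 0)"
      by (simp only: sum.inter_filter finite_lessThan)
    also have "\<dots> \<le> (\<Sum>j<N. ?f (z j))"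
      using bound(1) by (intro sum_mono) auto
    finally have "real (card {s. s < N \<and> z s \<in> F}) / N \<le> (\<Sum>j<N. ?f (z j)) / real N"
      by (rule divide_right_mono) simp
    with N show "real (card {s. s < N \<and> z s \<in> F}) / N < measure M F + e" by simp
  qed
qed

text \<open>Only upper bounds on frequencies are assumed: as frequencies and probabilities both sum to 1,
  they force convergence.\<close>

lemma frequency_tendsto:
  fixes p :: "nat \<Rightarrow> 'v \<Rightarrow> real"
  assumes V: "finite V" and sums: "\<And>N. 0 < N \<Longrightarrow> sum (p N) V = 1" "sum P V = 1"
    and upper: "\<And>v e. v \<in> V \<Longrightarrow> 0 < e \<Longrightarrow> eventually (\<lambda>N. p N v < P v + e) sequentially"
    and v: "v \<in> V"
  shows "(\<lambda>N. p N v) \<longlonglongrightarrow> P v"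
proof (rule order_tendstoI)
  fix a assume "P v < a"
  then show "eventually (\<lambda>N. p N v < a) sequentially"
    using upper[OF v, of "a - P v"] by simp
next
  fix a assume a: "a < P v"
  \<comment> \<open>The other \<open>card V - 1\<close> frequencies exceed their limits by less than
    \<open>e\<close> each, in total by at most \<open>(P v - a) - e\<close>; this leaves at least
    \<open>a + e\<close> for \<open>v\<close>.\<close>
  define e where "e = (P v - a) / card V"
  have cV: "0 < card V" using V v by (auto simp: card_gt_0_iff)
  then have e: "0 < e" using a by (simp add: e_def)
  have "eventually (\<lambda>N. \<forall>u\<in>V. p N u < P u + e) sequentially"
    using upper e V by (simp add: eventually_ball_finite_distrib)
  then have "eventually (\<lambda>N. (\<forall>u\<in>V. p N u < P u + e) \<and> 0 < N) sequentially"
    using eventually_gt_at_top[of "0::nat"] by (rule eventually_conj)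
  then show "eventually (\<lambda>N. a < p N v) sequentially"
  proof eventually_elim
    fix N assume N: "(\<forall>u\<in>V. p N u < P u + e) \<and> 0 < N"
    have "sum (p N) (V - {v}) \<le> (\<Sum>u\<in>V - {v}. P u + e)"
      using N by (intro sum_mono) (auto intro: less_imp_le)
    also have "\<dots> = sum P (V - {v}) + (card V - 1) * e"
      using V v by (simp add: sum.distrib)
    finally have "1 - p N v \<le> 1 - P v + (card V - 1) * e"
      using sums(1)[of N] sums(2) N sum.remove[OF V v, of "p N"] sum.remove[OF V v, of P] by linarith
    moreover have "card V * e = P v - a"
      using cV by (simp add: e_def)
    then have "(card V - 1) * e = P v - a - e"
      using cV by (simp add: of_nat_diff Suc_le_eq left_diff_distrib)
    ultimately show "a < p N v" using e by linarith
  qed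
qed

end

text \<open>Only the part of the closure outside the cell has to be null, so closed cells qualify
  automatically. This suffices for upper bounds on frequencies.\<close>

definition null_boundary :: "'a::topological_space measure \<Rightarrow> ('a \<Rightarrow> 'b) \<Rightarrow> bool" where
  "null_boundary M c \<longleftrightarrow> (\<forall>v. measure M (closure (c -` {v}) - c -` {v}) = 0)"

section \<open>Word frequencies along generic quasi-orbits\<close>

lemma quasi_orbit_density:
  assumes "quasi_orbit T z"
  shows "(\<lambda>N. real (card ({n. z (Suc n) \<noteq> T (z n)} \<inter> {..<N})) / real N) \<longlonglongrightarrow> 0"
proof -
  let ?a = "\<lambda>N. real (card ({n. z (Suc n) \<noteq> T (z n)} \<inter> {..<N})) / real N"
  have sup: "limsup (\<lambda>N. ereal (?a N)) = 0"
    using assms by (simp add: quasi_orbit_def upper_density_def)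
  have "0 \<le> liminf (\<lambda>N. ereal (?a N))"
    by (intro Liminf_bounded always_eventually) simp
  moreover have "liminf (\<lambda>N. ereal (?a N)) \<le> limsup (\<lambda>N. ereal (?a N))"
    by (rule Liminf_le_Limsup) simp
  ultimately have "liminf (\<lambda>N. ereal (?a N)) = 0"
    unfolding sup by (rule antisym[rotated])
  then have "(\<lambda>N. ereal (?a N)) \<longlonglongrightarrow> ereal 0"
    using sup by (intro Liminf_eq_Limsup) (simp_all add: zero_ereal_def)
  then show ?thesis unfolding lim_ereal .
qed

text \<open>A window without a break in \<open>B\<close> is a true itinerary, and each break lies in
  at most \<open>m\<close> windows. The additional \<open>m\<close> inside the bracket covers breaks
  at or beyond \<open>N\<close>.\<close>

lemma card_window_neq_name_le:
  fixes z :: "nat \<Rightarrow> 'a" and T :: "'a \<Rightarrow> 'a"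
  defines "B \<equiv> {n. z (Suc n) \<noteq> T (z n)}"
  shows "card {s. s < N \<and> window m (\<lambda>s. c (z s)) s \<noteq> name T c m (z s)} \<le> m * (card (B \<inter> {..<N}) + m)"
proof -
  have orbit: "z (s + i) = (T ^^ i) (z s)" if "\<And>k. k < i \<Longrightarrow> s + k \<notin> B" for s i
    using that
  proof (induction i)
    case (Suc i)
    have "z (Suc (s + i)) = T (z (s + i))"
      using Suc.prems[of i] by (simp add: B_def)
    moreover have "z (s + i) = (T ^^ i) (z s)"
      using Suc.prems by (intro Suc.IH) simp
    ultimately show ?case by simp
  qed simp
  have good: "window m (\<lambda>s. c (z s)) s = name T c m (z s)" if "\<forall>i<m. s + i \<notin> B" for s
    using that by (intro nth_equalityI) (simp_all add: orbit)
  have "card {s. s < N \<and> window m (\<lambda>s. c (z s)) s \<noteq> name T c m (z s)}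
      \<le> card (\<Union>i<m. {s. s < N \<and> s + i \<in> B})"
  proof (rule card_mono)
    show "finite (\<Union>i<m. {s. s < N \<and> s + i \<in> B})" by (intro finite_UN_I) simp_all
    show "{s. s < N \<and> window m (\<lambda>s. c (z s)) s \<noteq> name T c m (z s)} \<subseteq> (\<Union>i<m. {s. s < N \<and> s + i \<in> B})"
      using good by blast
  qed
  also have "\<dots> \<le> (\<Sum>i<m. card {s. s < N \<and> s + i \<in> B})"
    by (rule card_UN_le) simp
  also have "\<dots> \<le> (\<Sum>i<m. card (B \<inter> {..<N}) + m)"
  proof (rule sum_mono)
    fix i assume "i \<in> {..<m}"
    have "card {s. s < N \<and> s + i \<in> B} = card ((\<lambda>s. s + i) ` {s. s < N \<and> s + i \<in> B})"
      by (simp add: card_image)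
    also have "\<dots> \<le> card ((B \<inter> {..<N}) \<union> {N..<N + i})"
      by (intro card_mono) auto
    also have "\<dots> \<le> card (B \<inter> {..<N}) + card {N..<N + i}"
      by (rule card_Un_le)
    finally show "card {s. s < N \<and> s + i \<in> B} \<le> card (B \<inter> {..<N}) + m"
      using \<open>i \<in> {..<m}\<close> by simp
  qed
  finally show ?thesis by simp
qed

lemma push_uniform_diff_le:
  "\<bar>push {..<N} (\<lambda>_. 1 / real N) X v - push {..<N} (\<lambda>_. 1 / real N) Y v\<bar>
    \<le> real (card {s. s < N \<and> X s \<noteq> Y s}) / real N"
proof -
  have eq: "push {..<N} (\<lambda>_. 1 / real N) X v = (\<Sum>s<N. if X s = v then 1 / real N else 0)" for X
    unfolding push_def by (simp only: sum.inter_filter finite_lessThan)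
  have "\<bar>push {..<N} (\<lambda>_. 1 / real N) X v - push {..<N} (\<lambda>_. 1 / real N) Y v\<bar>
     = \<bar>\<Sum>s<N. (if X s = v then 1 / real N else 0) - (if Y s = v then 1 / real N else 0)\<bar>"
    unfolding eq sum_subtractf ..
  also have "\<dots> \<le> (\<Sum>s<N. \<bar>(if X s = v then 1 / real N else 0) - (if Y s = v then 1 / real N else 0)\<bar>)"
    by (rule sum_abs)
  also have "\<dots> \<le> (\<Sum>s<N. if X s \<noteq> Y s then 1 / real N else 0)"
    by (intro sum_mono) auto
  also have "\<dots> = (\<Sum>s\<in>{s\<in>{..<N}. X s \<noteq> Y s}. 1 / real N)"
    by (simp only: sum.inter_filter finite_lessThan)
  finally show ?thesis by simp
qed

lemma tendsto_x_ln_x: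
  fixes p :: "nat \<Rightarrow> real"
  assumes lim: "p \<longlonglongrightarrow> P" and p: "\<And>n. 0 \<le> p n" "\<And>n. p n \<le> 1"
  shows "(\<lambda>n. p n * ln (p n)) \<longlonglongrightarrow> P * ln P"
proof (cases "P = 0")
  case False
  then show ?thesis by (intro tendsto_intros lim)
next
  case True
  \<comment> \<open>At 0 the logarithm is discontinuous, so a rate is needed:
    \<open>ln y \<le> y - 1\<close> at \<open>y = 1 / sqrt x\<close>.\<close>
  have bound: "\<bar>x * ln x\<bar> \<le> 2 * sqrt x" if x: "0 \<le> x" "x \<le> 1" for x :: real
  proof (cases "x = 0")
    case False
    then have "0 < x" using x by simp
    have "- ln x = 2 * ln (1 / sqrt x)"
      using \<open>0 < x\<close> by (simp add: ln_div ln_sqrt)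
    also have "\<dots> \<le> 2 * (1 / sqrt x)"
      using ln_le_minus_one[of "1 / sqrt x"] \<open>0 < x\<close> by simp
    finally have "x * - ln x \<le> x * (2 * (1 / sqrt x))"
      using x by (intro mult_left_mono)
    also have "\<dots> = 2 * (x / sqrt x)" by simp
    also have "\<dots> = 2 * sqrt x"
      unfolding real_div_sqrt[OF x(1)] ..
    finally show ?thesis
      using x \<open>0 < x\<close> by (simp add: abs_mult)
  qed simp
  have "(\<lambda>n. 2 * sqrt (p n)) \<longlonglongrightarrow> 2 * sqrt P"
    by (intro tendsto_intros lim)
  then have "(\<lambda>n. 2 * sqrt (p n)) \<longlonglongrightarrow> 0" using True by simp
  then have "(\<lambda>n. p n * ln (p n)) \<longlonglongrightarrow> 0"
    by (rule Lim_null_comparison[rotated]) (use bound p in \<open>simp add: always_eventually\<close>)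
  then show ?thesis using True by simp
qed

locale topological_system = invariant_system M T
  for M :: "'a::metric_space measure" and T :: "'a \<Rightarrow> 'a" +
  assumes cont: "continuous_on UNIV T"

sublocale topological_system \<subseteq> metric_prob M ..

context topological_system
begin

lemma cont_pow: "continuous_on UNIV (T ^^ i)"
proof (induction i)
  case (Suc i)
  show ?case
    unfolding funpow.simps by (rule continuous_on_compose[OF Suc.IH continuous_on_subset[OF cont]]) simp
qed (simp add: id_def)

text \<open>By continuity of the iterates the closure of a cylinder is contained in the preimages of
  the closures of its factors. Hence it adds only points of the sets \<open>Z i\<close>, which are
  null by invariance.\<close>

lemma measure_closure_name_le:
  assumes c: "simple c" and nb: "null_boundary M c" and v: "length v = m"
  shows "measure M (closure (name T c m -` {v})) \<le> law M (name T c m) v"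
proof -
  define C where "C = name T c m -` {v}"
  define A where "A = (\<lambda>i. c -` {v ! i})"
  define Z where "Z = (\<lambda>i. (T ^^ i) -` (closure (A i) - A i))"
  have C: "C \<in> sets M"
    using simple_name[OF c] by (simp add: C_def simple_def sets_M)
  have mA: "closure (A i) - A i \<in> sets borel" for i
    using c by (auto simp: A_def simple_def)
  have Z: "Z i \<in> sets M" "measure M (Z i) = 0" for i
    using vimage_pow[OF mA] measure_pow[OF mA] nb by (simp_all add: Z_def sets_M A_def null_boundary_def)
  have C_iff: "x \<in> C \<longleftrightarrow> (\<forall>i<m. (T ^^ i) x \<in> A i)" for x
    using v by (auto simp: C_def A_def list_eq_iff_nth_eq)
  have cl: "closure C \<subseteq> (T ^^ i) -` closure (A i)" if "i < m" for i
  proof (rule closure_minimal)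
    show "C \<subseteq> (T ^^ i) -` closure (A i)"
      using C_iff that closure_subset by fast
    show "closed ((T ^^ i) -` closure (A i))"
      using cont_pow by (intro closed_vimage) simp_all
  qed
  have sub: "closure C \<subseteq> C \<union> (\<Union>i<m. Z i)"
  proof
    fix x assume x: "x \<in> closure C"
    show "x \<in> C \<union> (\<Union>i<m. Z i)"
    proof (cases "x \<in> C")
      case False
      then obtain i where "i < m" "(T ^^ i) x \<notin> A i" using C_iff by blast
      then show ?thesis using cl[of i] x unfolding Z_def by blast
    qed simp
  qed
  have mZ: "(\<Union>i<m. Z i) \<in> sets M" using Z(1) by (intro sets.finite_UN) simp_all
  have "measure M (closure C) \<le> measure M (C \<union> (\<Union>i<m. Z i))"
    using sub C mZ by (intro finite_measure_mono) simp_all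
  also have "\<dots> \<le> measure M C + measure M (\<Union>i<m. Z i)"
    using C mZ by (intro measure_Un_le)
  also have "measure M (\<Union>i<m. Z i) \<le> (\<Sum>i<m. measure M (Z i))"
    using Z(1) by (intro finite_measure_subadditive_finite) auto
  finally show ?thesis
    using Z(2) by (simp add: law_def C_def)
qed

text \<open>For itineraries, \<open>generic_closed\<close> applied to the closures of the cylinders
  gives the upper bounds that \<open>frequency_tendsto\<close> asks for. Windows inherit the limit
  because the breaks of the quasi-orbit have density 0.\<close>

lemma name_frequency_tendsto:
  assumes c: "simple c" "null_boundary M c" and L: "finite L" "range c \<subseteq> L"
    and z: "generic z M" "quasi_orbit T z" and v: "v \<in> {xs. set xs \<subseteq> L \<and> length xs = m}"
  shows "(\<lambda>N. push {..<N} (\<lambda>_. 1 / real N) (window m (\<lambda>s. c (z s))) v) \<longlonglongrightarrow> law M (name T c m) v"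
proof -
  let ?V = "{xs. set xs \<subseteq> L \<and> length xs = m}"
  let ?p = "\<lambda>N. push {..<N} (\<lambda>_. 1 / real N) (\<lambda>s. name T c m (z s))"
  let ?w = "\<lambda>N. push {..<N} (\<lambda>_. 1 / real N) (window m (\<lambda>s. c (z s)))"
  let ?B = "{n. z (Suc n) \<noteq> T (z n)}"
  have V: "finite ?V" using L(1) by (rule finite_lists_length_eq)
  have name_V: "name T c m x \<in> ?V" for x using name_in[OF L(2)] .
  have n: "simple (name T c m)" by (rule simple_name[OF c(1)])
  have "(\<lambda>N. ?p N v) \<longlonglongrightarrow> law M (name T c m) v"
  proof (rule frequency_tendsto[OF V _ _ _ v])
    show "sum (?p N) ?V = 1" if "0 < N" for N
      using sum_push[of "{..<N}" ?V "\<lambda>s. name T c m (z s)" "\<lambda>_. 1 / real N"] V name_V that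
      by (simp add: image_subset_iff)
    have "sum (law M (name T c m)) ?V = sum (law M (name T c m)) (range (name T c m))"
      using V name_V law_outside by (intro sum.mono_neutral_right) auto
    then show "sum (law M (name T c m)) ?V = 1" using sum_law[OF n] by simp
    show "eventually (\<lambda>N. ?p N u < law M (name T c m) u + e) sequentially"
      if u: "u \<in> ?V" and e: "0 < e" for u e
    proof -
      let ?C = "name T c m -` {u}"
      have "eventually (\<lambda>N. real (card {s. s < N \<and> z s \<in> closure ?C}) / N < measure M (closure ?C) + e) sequentially"
        using z(1) e by (intro generic_closed) simp_all
      then show ?thesis
      proof eventually_elim
        fix N assume N: "real (card {s. s < N \<and> z s \<in> closure ?C}) / N < measure M (closure ?C) + e"
        have "?p N u = real (card {s. s < N \<and> z s \<in> ?C}) / N"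
          by (simp add: push_def)
        also have "\<dots> \<le> real (card {s. s < N \<and> z s \<in> closure ?C}) / N"
          using closure_subset[of ?C] by (intro divide_right_mono) (auto intro!: card_mono)
        also note N
        also have "measure M (closure ?C) + e \<le> law M (name T c m) u + e"
          using measure_closure_name_le[OF c, of u m] u by simp
        finally show "?p N u < law M (name T c m) u + e" .
      qed
    qed
  qed
  moreover have "(\<lambda>N. ?w N v - ?p N v) \<longlonglongrightarrow> 0"
  proof (rule Lim_null_comparison)
    show "eventually (\<lambda>N. norm (?w N v - ?p N v)
        \<le> real m * (real (card (?B \<inter> {..<N})) / real N) + real (m * m) / real N) sequentially"
    proof (rule always_eventually, rule allI)
      fix N
      have "norm (?w N v - ?p N v)
        \<le> real (card {s. s < N \<and> window m (\<lambda>s. c (z s)) s \<noteq> name T c m (z s)}) / real N"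
        unfolding real_norm_def by (rule push_uniform_diff_le)
      also have "\<dots> \<le> real (m * (card (?B \<inter> {..<N}) + m)) / real N"
        by (intro divide_right_mono iffD2[OF of_nat_le_iff] card_window_neq_name_le) simp
      also have "\<dots> = real m * (real (card (?B \<inter> {..<N})) / real N) + real (m * m) / real N"
        by (simp add: distrib_left add_divide_distrib)
      finally show "norm (?w N v - ?p N v)
        \<le> real m * (real (card (?B \<inter> {..<N})) / real N) + real (m * m) / real N" .
    qed
    have "(\<lambda>N. real m * (real (card (?B \<inter> {..<N})) / real N) + real (m * m) / real N) \<longlonglongrightarrow> real m * 0 + 0"
      by (intro tendsto_add tendsto_mult tendsto_const quasi_orbit_density[OF z(2)] lim_const_over_n)
    then show "(\<lambda>N. real m * (real (card (?B \<inter> {..<N})) / real N) + real (m * m) / real N) \<longlonglongrightarrow> 0"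
      by simp
  qed
  ultimately have "(\<lambda>N. ?p N v + (?w N v - ?p N v)) \<longlonglongrightarrow> law M (name T c m) v + 0"
    by (rule tendsto_add)
  then show ?thesis by simp
qed

lemma block_entropy_tendsto:
  assumes c: "simple c" "null_boundary M c" and L: "finite L" "range c \<subseteq> L"
    and z: "generic z M" "quasi_orbit T z"
  shows "(\<lambda>N. shannon {xs. set xs \<subseteq> L \<and> length xs = m}
      (push {..<N} (\<lambda>_. 1 / real N) (window m (\<lambda>s. c (z s))))) \<longlonglongrightarrow> ent M (name T c m)"
proof -
  let ?V = "{xs. set xs \<subseteq> L \<and> length xs = m}"
  let ?w = "\<lambda>N. push {..<N} (\<lambda>_. 1 / real N) (window m (\<lambda>s. c (z s)))"
  have V: "finite ?V" using L(1) by (rule finite_lists_length_eq)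
  have w: "0 \<le> ?w N v" "?w N v \<le> 1" for N v
  proof -
    show "0 \<le> ?w N v" by (rule push_nonneg) simp
    have "?w N v \<le> (\<Sum>_<N. 1 / real N)"
      unfolding push_def by (rule sum_mono2) auto
    also have "\<dots> \<le> 1" by simp
    finally show "?w N v \<le> 1" .
  qed
  have "ent M (name T c m) = shannon ?V (law M (name T c m))"
    using V name_in[OF L(2)] by (intro ent_eq_shannon) auto
  moreover have "(\<lambda>N. shannon ?V (?w N)) \<longlonglongrightarrow> shannon ?V (law M (name T c m))"
    unfolding shannon_def
    by (intro tendsto_minus tendsto_sum tendsto_x_ln_x name_frequency_tendsto[OF c L z] w)
  ultimately show ?thesis by simp
qed

end

section \<open>Labellings by neighbourhoods of closed sets\<close>

lemma topological_systemI:
  assumes "M \<in> invariant_measures T" "continuous_on UNIV T"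
  shows "topological_system M T"
  using assms borel_measurable_continuous_onI[OF assms(2)] unfolding invariant_measures_def
  by (intro topological_system.intro invariant_system.intro borel_prob.intro
      borel_prob_axioms.intro invariant_system_axioms.intro topological_system_axioms.intro) auto

section \<open>Transfer of entropy along matched sequences\<close>

lemma entropy_wrt_le:
  fixes C :: real
  assumes "invariant_system M T" "invariant_system M' T" "simple c" "simple c'"
    and le: "\<And>m. ent M (name T c m) \<le> ent M' (name T c' m) + m * C"
  shows "entropy_wrt T M (fibres c) \<le> entropy_wrt T M' (fibres c') + C"
proof (rule LIMSEQ_le)
  show "(\<lambda>m. ent M (name T c m) / real m) \<longlonglongrightarrow> entropy_wrt T M (fibres c)"
    using assms(1,3) by (rule invariant_system.entropy_limit)
  have "(\<lambda>m. ent M' (name T c' m) / real m) \<longlonglongrightarrow> entropy_wrt T M' (fibres c')"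
    using assms(2,4) by (rule invariant_system.entropy_limit)
  then show "(\<lambda>m. ent M' (name T c' m) / real m + C) \<longlonglongrightarrow> entropy_wrt T M' (fibres c') + C"
    by (intro tendsto_add tendsto_const)
  show "\<exists>m0. \<forall>m\<ge>m0. ent M (name T c m) / real m \<le> ent M' (name T c' m) / real m + C"
  proof (intro exI[of _ 1] allI impI)
    fix m :: nat assume m: "1 \<le> m"
    have "ent M (name T c m) / real m \<le> (ent M' (name T c' m) + m * C) / real m"
      by (rule divide_right_mono[OF le]) simp
    also have "\<dots> = ent M' (name T c' m) / real m + C"
      using m by (simp add: add_divide_distrib)
    finally show "ent M (name T c m) / real m \<le> ent M' (name T c' m) / real m + C" .
  qed
qed

text \<open>The unmatched fraction is at most \<open>\<delta>\<close> from the matching plus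
  \<open>\<eta>\<close> from positions labelled \<open>None\<close>. The factor 6 combines the 3 of
  \<open>sum_unmatched_le\<close> with the two coordinates of the code. The term in
  \<open>m\<^sup>2\<close> vanishes as \<open>N\<close> grows with \<open>m\<close> fixed;
  \<open>m\<close> tends to infinity only afterwards.\<close>

lemma entropy_transfer:
  fixes z x :: "nat \<Rightarrow> 'a::metric_space" and c c' :: "'a \<Rightarrow> 'b option"
  assumes M: "topological_system M T" and M': "topological_system M' T"
    and z: "generic z M" "quasi_orbit T z" and x: "generic x M'" "quasi_orbit T x"
    and c: "simple c" "null_boundary M c" and c': "simple c'" "null_boundary M' c'"
    and L: "finite L" "range c \<subseteq> L" "range c' \<subseteq> L" "None \<in> L"
    and close: "\<And>y y'. dist y y' < \<delta> \<Longrightarrow> c y \<noteq> None \<Longrightarrow> c' y' = c y"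
    and f_bar: "f_bar \<delta> z x < ereal \<delta>" and small: "measure M {y. c y = None} < \<eta>"
    and q: "0 < q" "q < 1"
  shows "entropy_wrt T M (fibres c)
    \<le> entropy_wrt T M' (fibres c') + (6 * (\<delta> + \<eta>) * ln (card L / q) - 2 * ln (1 - q))"
proof (rule entropy_wrt_le)
  interpret M: topological_system M T by fact
  interpret M': topological_system M' T by fact
  show "invariant_system M T" "invariant_system M' T" by unfold_locales
  show "simple c" "simple c'" by fact+
  fix m
  let ?V = "{xs. set xs \<subseteq> L \<and> length xs = m}"
  let ?p = "\<lambda>N _. 1 / real N"
  let ?w = "\<lambda>s. c (z s)" and ?w' = "\<lambda>s. c' (x s)"
  let ?l = "ln (card L / q)"
  let ?bound = "\<lambda>N. shannon ?V (push {..<N} (?p N) (window m ?w'))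
    + 2 * (3 * m * (\<delta> + \<eta>) + real (2 * m\<^sup>2) / real N) * ?l - 2 * m * ln (1 - q)"
  have "1 \<le> card L" using L by (auto simp: Suc_le_eq card_gt_0_iff)
  then have lam: "0 \<le> ?l" using q by (simp add: pos_le_divide_eq)
  have "eventually (\<lambda>N. f_bar_n N \<delta> z x < \<delta>) sequentially"
    using Limsup_lessD[OF f_bar[unfolded f_bar_def]] by simp
  moreover have "eventually (\<lambda>N. real (card {s. s < N \<and> c (z s) = None}) / N < \<eta>) sequentially"
  proof -
    have "name T c 1 y = [c y]" for y by (simp add: name_def)
    then have "law M (name T c 1) [None] = measure M {y. c y = None}"
      by (simp add: law_def vimage_def)
    moreover have "push {..<N} (?p N) (window 1 ?w) [None] = real (card {s. s < N \<and> c (z s) = None}) / N" for N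
      by (simp add: push_def window_def)
    moreover have "(\<lambda>N. push {..<N} (?p N) (window 1 ?w) [None]) \<longlonglongrightarrow> law M (name T c 1) [None]"
      using L(4) by (intro M.name_frequency_tendsto[OF c L(1,2) z]) simp
    ultimately show ?thesis
      using order_tendstoD(2) small by fastforce
  qed
  ultimately have "eventually (\<lambda>N. shannon ?V (push {..<N} (?p N) (window m ?w)) \<le> ?bound N) sequentially"
    using eventually_gt_at_top[of "0::nat"]
  proof eventually_elim
    fix N :: nat
    assume f: "f_bar_n N \<delta> z x < \<delta>" and none: "real (card {s. s < N \<and> c (z s) = None}) / N < \<eta>"
      and N: "0 < N"
    have "Max (match_sizes N \<delta> z x) \<in> match_sizes N \<delta> z x"
      by (rule Max_in[OF finite_match_sizes match_sizes_nonempty])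
    then obtain D R \<pi> where match: "is_match N \<delta> z x D R \<pi>" and card_D: "card D = Max (match_sizes N \<delta> z x)"
      unfolding match_sizes_def by auto
    have DR: "D \<subseteq> {..<N}" "R \<subseteq> {..<N}" "bij_betw \<pi> D R" "mono_on D \<pi>"
      and near: "\<And>i. i \<in> D \<Longrightarrow> dist (z i) (x (\<pi> i)) < \<delta>"
      using match by (auto simp: is_match_def)
    have finD: "finite D" using DR(1) finite_subset by blast
    \<comment> \<open>Near a point labelled \<open>None\<close> nothing is known about the other
      label, so such pairs are dropped from the matching.\<close>
    define D' where "D' = {i \<in> D. c (z i) \<noteq> None}"
    interpret match N D' "\<pi> ` D'" \<pi>
    proof
      show "D' \<subseteq> {..<N}" using DR(1) by (auto simp: D'_def)
      show "\<pi> ` D' \<subseteq> {..<N}" using DR(2,3) by (auto simp: D'_def bij_betw_def)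
      show "bij_betw \<pi> D' (\<pi> ` D')"
        using DR(3) by (rule bij_betw_subset) (auto simp: D'_def)
      show "mono_on D' \<pi>"
        using DR(4) by (rule mono_on_subset) (auto simp: D'_def)
    qed
    have "card D \<le> card (D' \<union> {s. s < N \<and> c (z s) = None})"
      using DR(1) finD by (intro card_mono) (auto simp: D'_def)
    also have "\<dots> \<le> card D' + card {s. s < N \<and> c (z s) = None}"
      by (rule card_Un_le)
    finally have "real (card D) \<le> card D' + real (card {s. s < N \<and> c (z s) = None})"
      by linarith
    moreover have "real N - \<delta> * N < card D"
      using f N by (simp add: f_bar_n_def card_D field_simps)
    moreover have "real (card {s. s < N \<and> c (z s) = None}) < \<eta> * N"
      using none N by (simp add: pos_divide_less_eq)
    moreover have "card D' \<le> N"
      using card_mono[of "{..<N}" D'] DR(1) by (auto simp: D'_def)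
    ultimately have gap: "real (N - card D') \<le> (\<delta> + \<eta>) * N"
      by (simp add: of_nat_diff distrib_right)
    have "shannon ?V (push {..<N} (?p N) (window m ?w))
      \<le> shannon ?V (push {..<N} (?p N) (window m ?w'))
        + 2 * (real (3 * m * (N - card D') + 2 * m\<^sup>2) / real N) * ?l - 2 * m * ln (1 - q)"
    proof (rule block_entropy_le[OF _ L(1) _ _ q N])
      show "c (z i) = c' (x (\<pi> i))" if "i \<in> D'" for i
      proof -
        have "i \<in> D" "c (z i) \<noteq> None" using that by (simp_all add: D'_def)
        then show ?thesis using close[OF near] by simp
      qed
    qed (use L in auto)
    also have "2 * (real (3 * m * (N - card D') + 2 * m\<^sup>2) / real N) * ?l
        \<le> 2 * (3 * m * (\<delta> + \<eta>) + real (2 * m\<^sup>2) / real N) * ?l"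
    proof (intro mult_right_mono[OF _ lam] mult_left_mono)
      have "real (3 * m * (N - card D')) / N \<le> 3 * m * ((\<delta> + \<eta>) * N) / N"
        using mult_left_mono[OF gap, of "real (3 * m)"] by (intro divide_right_mono) simp_all
      then show "real (3 * m * (N - card D') + 2 * m\<^sup>2) / real N
          \<le> 3 * m * (\<delta> + \<eta>) + real (2 * m\<^sup>2) / real N"
        using N by (simp add: add_divide_distrib)
    qed simp
    finally show "shannon ?V (push {..<N} (?p N) (window m ?w)) \<le> ?bound N" by simp
  qed
  moreover have "(\<lambda>N. shannon ?V (push {..<N} (?p N) (window m ?w))) \<longlonglongrightarrow> ent M (name T c m)"
    by (rule M.block_entropy_tendsto[OF c L(1,2) z])
  moreover have "?bound \<longlonglongrightarrow> ent M' (name T c' m) + 2 * (3 * m * (\<delta> + \<eta>) + 0) * ?l - 2 * m * ln (1 - q)"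
    by (intro tendsto_intros M'.block_entropy_tendsto[OF c' L(1,3) x] lim_const_over_n)
  ultimately have "ent M (name T c m) \<le> ent M' (name T c' m) + 2 * (3 * m * (\<delta> + \<eta>) + 0) * ?l - 2 * m * ln (1 - q)"
    by (intro tendsto_le[OF sequentially_bot])
  also have "\<dots> = ent M' (name T c' m) + m * (6 * (\<delta> + \<eta>) * ?l - 2 * ln (1 - q))"
    by (simp add: algebra_simps)
  finally show "ent M (name T c m) \<le> ent M' (name T c' m) + m * (6 * (\<delta> + \<eta>) * ?l - 2 * ln (1 - q))" .
qed

text \<open>In a separated family the choice is unambiguous as soon as
  \<open>2 * r < \<rho>\<close>; \<open>None\<close> marks the points outside all the closed
  neighbourhoods.\<close>

definition label :: "('b \<Rightarrow> 'a::metric_space set) \<Rightarrow> 'b set \<Rightarrow> real \<Rightarrow> 'a \<Rightarrow> 'b option" where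
  "label K I r x = (if \<exists>i\<in>I. infdist x (K i) \<le> r then Some (SOME i. i \<in> I \<and> infdist x (K i) \<le> r) else None)"

locale separated_family =
  fixes K :: "'b \<Rightarrow> 'a::metric_space set" and I :: "'b set" and \<rho> :: real
  assumes finite_I: "finite I"
    and separated: "\<And>i j x. i \<in> I \<Longrightarrow> j \<in> I \<Longrightarrow> i \<noteq> j \<Longrightarrow> \<rho> \<le> infdist x (K i) + infdist x (K j)"
begin

lemma label_eq_None_iff: "label K I r x = None \<longleftrightarrow> (\<forall>i\<in>I. r < infdist x (K i))"
  by (simp add: label_def) (meson not_le)

lemma label_eq_Some_iff:
  assumes "2 * r < \<rho>"
  shows "label K I r x = Some i \<longleftrightarrow> i \<in> I \<and> infdist x (K i) \<le> r"
proof (cases "\<exists>i\<in>I. infdist x (K i) \<le> r")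
  case True
  let ?j = "SOME i. i \<in> I \<and> infdist x (K i) \<le> r"
  have j: "?j \<in> I \<and> infdist x (K ?j) \<le> r"
    using True by (intro someI_ex[of "\<lambda>i. i \<in> I \<and> infdist x (K i) \<le> r"]) blast
  have "i = ?j" if "i \<in> I" "infdist x (K i) \<le> r"
    using separated[OF that(1) conjunct1[OF j], of x] that j assms by linarith
  then show ?thesis
    using True j by (auto simp: label_def)
qed (auto simp: label_def)

lemma range_label: "2 * r < \<rho> \<Longrightarrow> range (label K I r) \<subseteq> insert None (Some ` I)"
proof
  fix a assume r: "2 * r < \<rho>" and "a \<in> range (label K I r)"
  then obtain x where "a = label K I r x" by blast
  then show "a \<in> insert None (Some ` I)"
    using label_eq_Some_iff[OF r, of x] by (cases "label K I r x") blast+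
qed

lemma closed_vimage_label:
  assumes "2 * r < \<rho>"
  shows "closed (label K I r -` {Some i})"
proof (cases "i \<in> I")
  case True
  then have "label K I r -` {Some i} = {x. infdist x (K i) \<le> r}"
    using label_eq_Some_iff[OF assms] by auto
  then show ?thesis
    by (simp add: closed_Collect_le continuous_intros)
next
  case False
  then have "label K I r -` {Some i} = {}"
    using label_eq_Some_iff[OF assms] by auto
  then show ?thesis by simp
qed

lemma vimage_label_None: "label K I r -` {None} = (\<Inter>i\<in>I. {x. r < infdist x (K i)})"
  using label_eq_None_iff by auto

lemma simple_label:
  assumes r: "2 * r < \<rho>"
  shows "simple (label K I r)"
  unfolding simple_def
proof (intro conjI allI)
  show "finite (range (label K I r))"
    using finite_subset[OF range_label[OF r]] finite_I by simp
  have "open (label K I r -` {None})"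
    unfolding vimage_label_None using finite_I
    by (intro open_INT ballI open_Collect_less continuous_intros)
  then show "label K I r -` {v} \<in> sets borel" for v
    using closed_vimage_label[OF r] by (cases v) auto
qed

text \<open>The neighbourhoods are closed, so only the open cell of \<open>None\<close> can lose
  mass; what its closure adds lies on the spheres of radius \<open>r\<close>.\<close>

lemma null_boundary_label:
  assumes M: "borel_prob M" and r: "2 * r < \<rho>"
    and null: "\<And>i. i \<in> I \<Longrightarrow> measure M {x. infdist x (K i) = r} = 0"
  shows "null_boundary M (label K I r)"
  unfolding null_boundary_def
proof
  interpret borel_prob M by fact
  fix v
  show "measure M (closure (label K I r -` {v}) - label K I r -` {v}) = 0"
  proof (cases v)
    case (Some i)
    then show ?thesis
      using closed_vimage_label[OF r, of i] by simp
  next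
    case None
    have "closure (\<Inter>i\<in>I. {x. r < infdist x (K i)}) \<subseteq> (\<Inter>i\<in>I. {x. r \<le> infdist x (K i)})"
    proof (rule closure_minimal)
      show "closed (\<Inter>i\<in>I. {x. r \<le> infdist x (K i)})"
        by (intro closed_INT ballI closed_Collect_le continuous_intros)
    qed (auto intro: less_imp_le)
    then have sub: "closure (label K I r -` {v}) - label K I r -` {v} \<subseteq> (\<Union>i\<in>I. {x. infdist x (K i) = r})"
      unfolding None vimage_label_None by force
    have S: "{x. infdist x (K i) = r} \<in> sets M" for i
      unfolding sets_M by (intro borel_closed closed_Collect_eq continuous_intros)
    have "measure M (closure (label K I r -` {v}) - label K I r -` {v}) \<le> measure M (\<Union>i\<in>I. {x. infdist x (K i) = r})"
      using sub finite_I S by (intro finite_measure_mono sets.finite_UN)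
    also have "\<dots> \<le> (\<Sum>i\<in>I. measure M {x. infdist x (K i) = r})"
      using finite_I S by (intro finite_measure_subadditive_finite) auto
    also have "\<dots> = 0" using null by simp
    finally show ?thesis by (simp add: antisym)
  qed
qed

text \<open>By the triangle inequality the larger radius absorbs the displacement
  \<open>\<delta>\<close>, and it is still small enough for the label to be unique.\<close>

lemma label_near:
  assumes "2 * r' < \<rho>" "r + \<delta> \<le> r'" "2 * r < \<rho>" "dist y y' < \<delta>" "label K I r y \<noteq> None"
  shows "label K I r' y' = label K I r y"
proof -
  obtain i where i: "label K I r y = Some i" using assms(5) by auto
  then have "i \<in> I" "infdist y (K i) \<le> r" using label_eq_Some_iff[OF assms(3)] by auto
  moreover have "infdist y' (K i) \<le> infdist y (K i) + dist y' y" by (rule infdist_triangle)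
  ultimately have "label K I r' y' = Some i"
    using label_eq_Some_iff[OF assms(1)] assms(2,4) by (simp add: dist_commute)
  then show ?thesis using i by simp
qed

end

section \<open>Null radii, separation and closed cores\<close>

lemma (in borel_prob) obtain_null_radius:
  fixes g :: "'b \<Rightarrow> 'a \<Rightarrow> real"
  assumes I: "finite I" and g: "\<And>i. i \<in> I \<Longrightarrow> g i \<in> borel_measurable borel" and ab: "a < b"
  obtains r where "a < r" "r < b" "\<And>i. i \<in> I \<Longrightarrow> measure M {x. g i x = r} = 0"
proof -
  \<comment> \<open>The masses of the level sets are the point masses of a probability measure on
    the line, which has only countably many atoms.\<close>
  have count: "countable {r. measure M {x. g i x = r} \<noteq> 0}" if "i \<in> I" for i
  proof -
    have gi: "g i \<in> measurable M borel"
      using g[OF that] sets_M by (simp cong: measurable_cong_sets)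
    interpret D: prob_space "distr M borel (g i)" by (rule prob_space_distr[OF gi])
    have "measure (distr M borel (g i)) {r} = measure M {x. g i x = r}" for r
      using gi by (subst measure_distr) (auto simp: vimage_def)
    then show ?thesis using D.countable_support by simp
  qed
  have "countable (\<Union>i\<in>I. {r. measure M {x. g i x = r} \<noteq> 0})"
    using count countable_finite[OF I] by (intro countable_UN)
  moreover have "uncountable {a<..<b}"
    using ab by (simp add: uncountable_open_interval)
  ultimately have "\<not> {a<..<b} \<subseteq> (\<Union>i\<in>I. {r. measure M {x. g i x = r} \<noteq> 0})"
    by (metis countable_subset)
  then obtain r where "r \<in> {a<..<b}" "r \<notin> (\<Union>i\<in>I. {r. measure M {x. g i x = r} \<noteq> 0})"
    by blast
  then show ?thesis using that[of r] by simp
qed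

lemma obtain_separation:
  fixes K :: "'b \<Rightarrow> 'a::metric_space set"
  assumes X: "compact (UNIV :: 'a set)" and I: "finite I"
    and K: "\<And>i. i \<in> I \<Longrightarrow> closed (K i)" "\<And>i. i \<in> I \<Longrightarrow> K i \<noteq> {}"
    and disj: "\<And>i j. i \<in> I \<Longrightarrow> j \<in> I \<Longrightarrow> i \<noteq> j \<Longrightarrow> K i \<inter> K j = {}"
  obtains \<rho> where "0 < \<rho>" "separated_family K I \<rho>"
proof -
  let ?P = "{(i, j). i \<in> I \<and> j \<in> I \<and> i \<noteq> j}"
  have "\<exists>d>0. \<forall>x. d \<le> infdist x (K i) + infdist x (K j)" if "(i, j) \<in> ?P" for i j
  proof -
    let ?g = "\<lambda>x. infdist x (K i) + infdist x (K j)"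
    have "continuous_on UNIV ?g" by (intro continuous_intros)
    \<comment> \<open>Compactness enters here: the sum of the two distances attains its minimum,
      which is positive because no point lies in both closed sets.\<close>
    then obtain x0 where x0: "\<forall>x. ?g x0 \<le> ?g x"
      using continuous_attains_inf[OF X, of ?g] by blast
    have "x0 \<notin> K i \<or> x0 \<notin> K j" using disj[of i j] that by auto
    moreover have "x0 \<notin> K k \<Longrightarrow> 0 < infdist x0 (K k)" if "k \<in> I" for k
      by (rule infdist_pos_not_in_closed[OF K[OF that]])
    ultimately have "0 < infdist x0 (K i) \<or> 0 < infdist x0 (K j)"
      using that by blast
    then have "0 < ?g x0"
      using infdist_nonneg[of x0 "K i"] infdist_nonneg[of x0 "K j"] by linarith
    then show ?thesis using x0 by blast
  qed
  then have "\<forall>p\<in>?P. \<exists>d>0. \<forall>x. d \<le> infdist x (K (fst p)) + infdist x (K (snd p))"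
    by (intro ballI) (simp add: case_prod_unfold)
  from bchoice[OF this] obtain d where d: "\<forall>p\<in>?P. 0 < d p \<and> (\<forall>x. d p \<le> infdist x (K (fst p)) + infdist x (K (snd p)))"
    by (elim exE)
  have "?P \<subseteq> I \<times> I" by auto
  then have fin: "finite ?P" using I finite_subset by blast
  \<comment> \<open>The 1 keeps the minimum defined when there are no two distinct indices.\<close>
  define \<rho> where "\<rho> = Min (insert 1 (d ` ?P))"
  have "0 < \<rho>" unfolding \<rho>_def using fin d by (subst Min_gr_iff) auto
  moreover have "separated_family K I \<rho>"
  proof
    fix i j x assume ij: "i \<in> I" "j \<in> I" "i \<noteq> j"
    then have "\<rho> \<le> d (i, j)"
      unfolding \<rho>_def using fin by (intro Min_le) auto
    moreover have "d (i, j) \<le> infdist x (K i) + infdist x (K j)"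
      using bspec[OF d, of "(i, j)"] ij by simp
    ultimately show "\<rho> \<le> infdist x (K i) + infdist x (K j)" by linarith
  qed (rule I)
  ultimately show ?thesis by (rule that)
qed

lemma partition_label:
  assumes "finite_meas_partition M P" "space M = UNIV" "sets M = sets borel"
  obtains c where "simple c" "fibres c = P" "range c = P" "\<And>x. x \<in> c x"
proof -
  have P: "finite P" "P \<subseteq> sets borel" "partition_on UNIV P"
    using assms by (simp_all add: finite_meas_partition_def)
  have "\<forall>x. \<exists>A. A \<in> P \<and> x \<in> A"
    using partition_onD1[OF P(3)] by blast
  from choice[OF this] obtain c where c: "\<And>x. c x \<in> P" "\<And>x. x \<in> c x"
    by blast
  have c_eq: "c x = A" if "A \<in> P" "x \<in> A" for x A
    using disjointD[OF partition_onD2[OF P(3)] c(1)[of x] that(1)] c(2)[of x] that(2) by blast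
  have fib: "c -` {A} = A" if "A \<in> P" for A
  proof (intro equalityI subsetI)
    show "x \<in> A" if "x \<in> c -` {A}" for x using c(2)[of x] that by simp
    show "x \<in> c -` {A}" if "x \<in> A" for x using c_eq[OF \<open>A \<in> P\<close> that] by simp
  qed
  have range: "range c = P"
  proof (intro equalityI subsetI)
    show "A \<in> P" if "A \<in> range c" for A using c(1) that by blast
    show "A \<in> range c" if "A \<in> P" for A
    proof -
      have "A \<noteq> {}" using partition_onD3[OF P(3)] that by blast
      then obtain x where "x \<in> A" by blast
      then show ?thesis using c_eq[OF that] by blast
    qed
  qed
  have "c -` {A} \<in> sets borel" for A
  proof (cases "A \<in> P")
    case True
    then show ?thesis using fib P(2) by auto
  next
    case False
    then have "c -` {A} = {}" using c(1) by auto
    then show ?thesis by simp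
  qed
  then have "simple c"
    using P(1) range by (simp add: simple_def)
  moreover have "fibres c = P"
    unfolding fibres_image range using fib by simp
  ultimately show ?thesis using range c(2) by (rule that)
qed

lemma fk_bar_lessD:
  assumes "fk_bar x z < d"
  obtains \<delta> where "0 < \<delta>" "\<delta> < d" "f_bar \<delta> x z < ereal \<delta>"
proof -
  \<comment> \<open>The infimum is informative only over a nonempty set; 2 belongs to it because
    \<open>f_bar\<close> never exceeds 1.\<close>
  have "f_bar 2 x z \<le> 1"
    unfolding f_bar_def
    by (intro Limsup_bounded always_eventually) (simp add: f_bar_n_def one_ereal_def)
  also have "1 < ereal 2" by (simp add: one_ereal_def)
  finally have "2 \<in> {\<delta>. 0 < \<delta> \<and> f_bar \<delta> x z < ereal \<delta>}" by simp
  then have "{\<delta>. 0 < \<delta> \<and> f_bar \<delta> x z < ereal \<delta>} \<noteq> {}" by blast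
  from cInf_lessD[OF this] assms show ?thesis
    unfolding fk_bar_def using that by blast
qed

lemma (in topological_system) closed_cores:
  assumes P: "finite_meas_partition M P" and \<eta>: "0 < \<eta>"
  obtains K where "\<And>A. A \<in> P \<Longrightarrow> closed (K A) \<and> K A \<noteq> {} \<and> K A \<subseteq> A"
    "measure M (\<Union>A\<in>P. A - K A) < \<eta>"
proof -
  have P': "finite P" "P \<subseteq> sets borel" "partition_on UNIV P"
    using P by (simp_all add: finite_meas_partition_def sets_M)
  \<comment> \<open>The summand 1 makes \<open>card P * e\<close> strictly smaller than
    \<open>\<eta>\<close>.\<close>
  define e where "e = \<eta> / (card P + 1)"
  have e: "0 < e" using \<eta> by (simp add: e_def)
  have "\<forall>A\<in>P. \<exists>K. closed K \<and> K \<noteq> {} \<and> K \<subseteq> A \<and> measure M (A - K) < e"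
  proof
    fix A assume A: "A \<in> P"
    then have mA: "A \<in> sets borel" using P'(2) by blast
    obtain F where F: "closed F" "F \<subseteq> A" "measure M (A - F) < e"
      using mA e by (rule closed_inner_approximation)
    \<comment> \<open>A point of \<open>A\<close> is added to keep the core nonempty: with
      \<open>infdist\<close> to the empty set being 0, an empty core would have all of
      \<open>X\<close> as its neighbourhood.\<close>
    have "A \<noteq> {}" using partition_onD3[OF P'(3)] A by blast
    then obtain a where a: "a \<in> A" by blast
    have "measure M (A - insert a F) \<le> measure M (A - F)"
      using mA F(1) by (intro finite_measure_mono) (auto simp: sets_M)
    then have "closed (insert a F) \<and> insert a F \<noteq> {} \<and> insert a F \<subseteq> A \<and> measure M (A - insert a F) < e"
      using F a by simp
    then show "\<exists>K. closed K \<and> K \<noteq> {} \<and> K \<subseteq> A \<and> measure M (A - K) < e" by blast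
  qed
  from bchoice[OF this] obtain K
    where K: "\<forall>A\<in>P. closed (K A) \<and> K A \<noteq> {} \<and> K A \<subseteq> A \<and> measure M (A - K A) < e"
    by (elim exE)
  have mK: "A - K A \<in> sets M" if "A \<in> P" for A
    using K P'(2) that by (auto simp: sets_M)
  have "measure M (\<Union>A\<in>P. A - K A) \<le> (\<Sum>A\<in>P. measure M (A - K A))"
    using P'(1) mK by (intro finite_measure_subadditive_finite) auto
  also have "\<dots> \<le> (\<Sum>A\<in>P. e)"
    using K by (intro sum_mono) (simp add: less_imp_le)
  also have "\<dots> = card P * e" by simp
  also have "\<dots> < (card P + 1) * e" using e by simp
  also have "\<dots> = \<eta>" by (simp add: e_def)
  finally have "measure M (\<Union>A\<in>P. A - K A) < \<eta>" .
  then show ?thesis using K that[of K] by simp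
qed

lemma entropy_wrt_le_KS:
  assumes M: "topological_system M T" and c: "simple c"
  shows "ereal (entropy_wrt T M (fibres c)) \<le> KS_entropy T M"
proof -
  interpret topological_system M T by fact
  have "finite_meas_partition M (fibres c)"
    using c space_M sets_M by (rule fibres_meas_partition)
  then show ?thesis
    unfolding KS_entropy_def by (intro SUP_upper) simp
qed

text \<open>The bound \<open>d\<close> is uniform in \<open>M'\<close> and \<open>x\<close>, so it
  applies to all late terms of the sequence at once.\<close>

lemma entropy_wrt_le_of_fk_close:
  fixes T :: "'a::metric_space \<Rightarrow> 'a"
  assumes X: "compact (UNIV :: 'a set)" and M: "topological_system M T"
    and z: "generic z M" "quasi_orbit T z"
    and P: "finite_meas_partition M P" and \<epsilon>: "0 < \<epsilon>"
  obtains d where "0 < d"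
    "\<And>M' x. topological_system M' T \<Longrightarrow> generic x M' \<Longrightarrow> quasi_orbit T x \<Longrightarrow> fk_bar z x < d \<Longrightarrow>
      ereal (entropy_wrt T M P - \<epsilon>) \<le> KS_entropy T M'"
proof -
  interpret M: topological_system M T by fact
  obtain c0 where c0: "simple c0" "fibres c0 = P" "range c0 = P" "\<And>x. x \<in> c0 x"
    by (rule partition_label[OF P M.space_M M.sets_M]) blast
  have finP: "finite P" and part: "partition_on UNIV P"
    using P by (simp_all add: finite_meas_partition_def)
  let ?L = "insert None (Some ` P)"
  \<comment> \<open>This makes \<open>- ln (1 - q) = \<epsilon> / 8\<close>. The marker cost arises
    once in the approximation of \<open>P\<close> and twice in the transfer, in total
    \<open>3 * \<epsilon> / 8\<close>.\<close>
  define q where "q = 1 - exp (- \<epsilon> / 8)"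
  have q: "0 < q" "q < 1" and ln_q: "ln (1 - q) = - \<epsilon> / 8"
    using \<epsilon> by (simp_all add: q_def)
  define l where "l = ln (card ?L / q)"
  have "P \<noteq> {}" using c0(3) by blast
  then have cP: "1 \<le> card P" "card P \<le> card ?L"
    using finP card_mono[of ?L "Some ` P"] by (auto simp: Suc_le_eq card_gt_0_iff card_image)
  then have l: "0 \<le> l" "ln (card P / q) \<le> l"
    using q by (auto simp: l_def pos_le_divide_eq divide_right_mono)
  \<comment> \<open>Errors cost \<open>\<eta> * l\<close> in the approximation and at most
    \<open>12 * \<eta> * l\<close> in the transfer, together at most
    \<open>13 * \<epsilon> / 40\<close>. With the marker cost this is below
    \<open>\<epsilon>\<close>. The denominator \<open>l + 1\<close> is positive even if
    \<open>l = 0\<close>.\<close>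
  define \<eta> where "\<eta> = \<epsilon> / 40 / (l + 1)"
  have \<eta>: "0 < \<eta>" using \<epsilon> l by (simp add: \<eta>_def)
  have "l + 1 \<noteq> 0" using l by simp
  then have "\<eta> * (l + 1) = \<epsilon> / 40"
    using nonzero_eq_divide_eq[of "l + 1" \<eta> "\<epsilon> / 40"] \<eta>_def by blast
  then have \<eta>l: "40 * (\<eta> * l) \<le> \<epsilon>" using \<eta> by (simp add: distrib_left)
  obtain K where K: "\<And>A. A \<in> P \<Longrightarrow> closed (K A) \<and> K A \<noteq> {} \<and> K A \<subseteq> A"
    and rest: "measure M (\<Union>A\<in>P. A - K A) < \<eta>"
    using M.closed_cores[OF P \<eta>] by blast
  have disj: "K A \<inter> K B = {}" if "A \<in> P" "B \<in> P" "A \<noteq> B" for A B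
    using disjointD[OF partition_onD2[OF part] that] K[OF that(1)] K[OF that(2)] by blast
  obtain \<rho> where \<rho>: "0 < \<rho>" and sep: "separated_family K P \<rho>"
    using obtain_separation[OF X finP, of K] K disj by metis
  interpret separated_family K P \<rho> by fact
  have meas: "(\<lambda>x. infdist x (K A)) \<in> borel_measurable borel" for A
    by (intro borel_measurable_continuous_onI continuous_intros)
  obtain r where r: "0 < r" "r < \<rho> / 8" and null: "\<And>A. A \<in> P \<Longrightarrow> measure M {x. infdist x (K A) = r} = 0"
    using M.obtain_null_radius[OF finP, of "\<lambda>A x. infdist x (K A)" 0 "\<rho> / 8"] meas \<rho> by auto
  let ?c = "label K P r"
  have r2: "2 * r < \<rho>" using r by linarith
  have c: "simple ?c" "null_boundary M ?c" "range ?c \<subseteq> ?L"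
    using simple_label[OF r2] null_boundary_label[OF M.borel_prob_axioms r2 null] range_label[OF r2] by blast+
  have "{x. ?c x \<noteq> Some (c0 x)} \<subseteq> (\<Union>A\<in>P. A - K A)"
  proof
    fix x assume x: "x \<in> {x. ?c x \<noteq> Some (c0 x)}"
    have in_P: "c0 x \<in> P" using c0(3) by blast
    then have "\<not> infdist x (K (c0 x)) \<le> r"
      using x label_eq_Some_iff[OF r2, of x "c0 x"] by simp
    then have "x \<notin> K (c0 x)" using r(1) by auto
    then show "x \<in> (\<Union>A\<in>P. A - K A)" using in_P c0(4) by blast
  qed
  moreover have mrest: "(\<Union>A\<in>P. A - K A) \<in> sets M"
    using finP P K by (intro sets.finite_UN sets.Diff) (auto simp: finite_meas_partition_def M.sets_M)
  ultimately have close: "measure M {x. ?c x \<noteq> Some (c0 x)} < \<eta>"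
    using M.finite_measure_mono rest by (meson le_less_trans)
  have none: "measure M {x. ?c x = None} < \<eta>"
  proof -
    have "{x. ?c x \<noteq> Some (c0 x)} \<in> sets M"
      using simple_vimage[OF simple_Pair[OF c(1) c0(1)], of "{(u, v). u \<noteq> Some v}"]
      by (simp add: vimage_def M.sets_M)
    then have "measure M {x. ?c x = None} \<le> measure M {x. ?c x \<noteq> Some (c0 x)}"
      by (intro M.finite_measure_mono) auto
    then show ?thesis using close by simp
  qed
  have "entropy_wrt T M (fibres c0) \<le> entropy_wrt T M (fibres ?c) + (\<eta> * ln (card P / q) - ln (1 - q))"
    using M.ent_name_approx[OF c0(1) c(1) finP _ q less_imp_le[OF close]] c0(1,3) c(1)
    by (intro entropy_wrt_le[OF M.invariant_system_axioms M.invariant_system_axioms]) simp_all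
  moreover have "\<eta> * ln (card P / q) \<le> \<eta> * l"
    using l \<eta> by (intro mult_left_mono) simp_all
  ultimately have P_le: "entropy_wrt T M P \<le> entropy_wrt T M (fibres ?c) + (\<eta> * l + \<epsilon> / 8)"
    unfolding c0(2) ln_q by simp
  show ?thesis
  proof (rule that[of "min \<eta> (\<rho> / 8)"])
    show "0 < min \<eta> (\<rho> / 8)" using \<eta> \<rho> by simp
    fix M' x
    assume M': "topological_system M' T" and x: "generic x M'" "quasi_orbit T x"
      and fk: "fk_bar z x < min \<eta> (\<rho> / 8)"
    interpret M': topological_system M' T by fact
    obtain \<delta> where \<delta>: "0 < \<delta>" "\<delta> < min \<eta> (\<rho> / 8)" "f_bar \<delta> z x < ereal \<delta>"
      using fk by (rule fk_bar_lessD)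
    \<comment> \<open>As \<open>r\<close> and \<open>\<delta>\<close> are below
      \<open>\<rho> / 8\<close>, every radius above \<open>\<rho> / 4\<close> exceeds
      \<open>r + \<delta>\<close>, and one below \<open>\<rho> / 3\<close> keeps labels unique. Only
      the choice within this interval depends on \<open>M'\<close>.\<close>
    obtain r' where r': "\<rho> / 4 < r'" "r' < \<rho> / 3"
      and null': "\<And>A. A \<in> P \<Longrightarrow> measure M' {x. infdist x (K A) = r'} = 0"
      using M'.obtain_null_radius[OF finP, of "\<lambda>A x. infdist x (K A)" "\<rho> / 4" "\<rho> / 3"] meas \<rho> by auto
    let ?c' = "label K P r'"
    have r2': "2 * r' < \<rho>" "r + \<delta> \<le> r'" using r r' \<delta> \<rho> by linarith+
    have c': "simple ?c'" "null_boundary M' ?c'" "range ?c' \<subseteq> ?L"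
      using simple_label[OF r2'(1)] null_boundary_label[OF M'.borel_prob_axioms r2'(1) null']
        range_label[OF r2'(1)] by blast+
    have "entropy_wrt T M (fibres ?c)
      \<le> entropy_wrt T M' (fibres ?c') + (6 * (\<delta> + \<eta>) * ln (card ?L / q) - 2 * ln (1 - q))"
      using finP label_near[OF r2' r2] \<delta>(3) none q
      by (intro entropy_transfer[OF M M' z x c(1,2) c'(1,2) _ c(3) c'(3)]) simp_all
    moreover have "6 * (\<delta> + \<eta>) * l \<le> 12 * \<eta> * l"
      using \<delta>(2) l(1) by (intro mult_right_mono) simp_all
    ultimately have "entropy_wrt T M P - \<epsilon> \<le> entropy_wrt T M' (fibres ?c')"
      using P_le \<eta>l \<epsilon> unfolding l_def[symmetric] ln_q by simp
    then show "ereal (entropy_wrt T M P - \<epsilon>) \<le> KS_entropy T M'"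
      using entropy_wrt_le_KS[OF M' c'(1)] by (meson ereal_less_eq(3) order_trans)
  qed
qed

theorem theorem8p1:
  fixes T :: "'a::metric_space \<Rightarrow> 'a"
    and \<mu> :: "nat \<Rightarrow> 'a measure"
    and \<mu>\<^sub>0 :: "'a measure"
  assumes "compact (UNIV :: 'a set)"
    and "continuous_on UNIV T"
    and "\<And>n. n \<ge> 1 \<Longrightarrow> \<mu> n \<in> invariant_measures T"
    and "\<mu>\<^sub>0 \<in> invariant_measures T"
    and "fk_converges T \<mu> \<mu>\<^sub>0"
  shows "KS_entropy T \<mu>\<^sub>0 \<le> liminf (\<lambda>n. KS_entropy T (\<mu> n))"
  unfolding KS_entropy_def[of T \<mu>\<^sub>0]
proof (rule SUP_least)
  fix P assume "P \<in> {P. finite_meas_partition \<mu>\<^sub>0 P}"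
  then have P: "finite_meas_partition \<mu>\<^sub>0 P" by simp
  have \<mu>0: "topological_system \<mu>\<^sub>0 T"
    using assms(4,2) by (rule topological_systemI)
  obtain x z where x: "\<And>n. 1 \<le> n \<Longrightarrow> quasi_orbit T (x n)" "\<And>n. 1 \<le> n \<Longrightarrow> generic (x n) (\<mu> n)"
    and z: "quasi_orbit T z" "generic z \<mu>\<^sub>0" and lim: "(\<lambda>n. fk_bar z (x n)) \<longlonglongrightarrow> 0"
    using assms(5) unfolding fk_converges_def by blast
  show "ereal (entropy_wrt T \<mu>\<^sub>0 P) \<le> liminf (\<lambda>n. KS_entropy T (\<mu> n))"
  proof (rule ereal_le_epsilon2)
    fix \<epsilon> :: real assume \<epsilon>: "0 < \<epsilon>"
    obtain d where "0 < d" and d: "\<And>M' x. topological_system M' T \<Longrightarrow> generic x M' \<Longrightarrow> quasi_orbit T x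
        \<Longrightarrow> fk_bar z x < d \<Longrightarrow> ereal (entropy_wrt T \<mu>\<^sub>0 P - \<epsilon>) \<le> KS_entropy T M'"
      using entropy_wrt_le_of_fk_close[OF assms(1) \<mu>0 z(2,1) P \<epsilon>] by blast
    have "eventually (\<lambda>n. fk_bar z (x n) < d) sequentially"
      using lim \<open>0 < d\<close> by (rule order_tendstoD(2))
    then have "eventually (\<lambda>n. ereal (entropy_wrt T \<mu>\<^sub>0 P - \<epsilon>) \<le> KS_entropy T (\<mu> n)) sequentially"
      \<comment> \<open>Nothing is assumed about index 0.\<close>
      using eventually_ge_at_top[of "1::nat"]
    proof eventually_elim
      case (elim n)
      then show ?case
        using topological_systemI[OF assms(3) assms(2)] x by (intro d[of "\<mu> n" "x n"]) simp_all
    qed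
    then have "ereal (entropy_wrt T \<mu>\<^sub>0 P - \<epsilon>) \<le> liminf (\<lambda>n. KS_entropy T (\<mu> n))"
      by (rule Liminf_bounded)
    then show "ereal (entropy_wrt T \<mu>\<^sub>0 P) \<le> liminf (\<lambda>n. KS_entropy T (\<mu> n)) + ereal \<epsilon>"
      by (cases "liminf (\<lambda>n. KS_entropy T (\<mu> n))") simp_all
  qed
qed

end
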